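(* The Alexandroff duplicate of the Cantor set is not homeomorphic to the edge-end space $\Omega_E(G)$ of any graph $G$, although it is homeomorphic to the end space $\Omega(H)$ of some graph $H$.
   Context: Graphs are simple and undirected, of arbitrary cardinality. A ray is a one-way infinite path; its tails are its infinite connected subgraphs. A finite set $S\subset V(G)$ (resp. a finite set $F\subset E(G)$) separates two rays $r,s$ of $G$ if $r$ and $s$ have tails in different connected components of $G\setminus S$ (resp. of $G\setminus F$). Ends: for rays $r,s$ of $G$ write $r\sim s$ if no finite $S\subset V(G)$ separates them. This is an equivalence relation; the class of $r$ is the end $[r]$, and $\Omega(G)$ is the set of ends, with the topology whose basic open neighborhoods of $[r]$ are $\Omega(S,[r])=\{[s]\in\Omega(G): S \text{ does not separate } r \text{ and } s\}$ for finite $S\subset V(G)$. Edge-ends: write $r\sim_E s$ if no finite $F\subset E(G)$ separates them. This is an equivalence relation; the class of $r$ is the edge-end $[r]_E$, and $\Omega_E(G)$ is the set of edge-ends, with the topology whose basic open neighborhoods of $[r]_E$ are $\Omega_E(F,[r]_E)=\{[s]_E\in\Omega_E(G): F \text{ does not separate } r \text{ and } s\}$ for finite $F\subset E(G)$. The Alexandroff duplicate of a space $C$ is the set $C\times\{0,1\}$ with the topology in which every point $(x,1)$ is isolated and the basic open neighborhoods of $(x,0)$ are the sets $(U\times\{0,1\})\setminus\{(x,1)\}$ with $U$ an open neighborhood of $x$ in $C$. Here $C=2^{\omega}$ is the Cantor set. *)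

theory Defs
  imports "HOL-Analysis.Analysis"
begin

record 'a ugraph =
  verts :: "'a set"
  edges :: "'a set set"

definition simple_graph :: "'a ugraph \<Rightarrow> bool" where
  "simple_graph G \<longleftrightarrow> (\<forall>e\<in>edges G. e \<subseteq> verts G \<and> card e = 2)"

definition subgraph :: "'a ugraph \<Rightarrow> 'a ugraph \<Rightarrow> bool" where
  "subgraph H G \<longleftrightarrow> simple_graph H \<and> verts H \<subseteq> verts G \<and> edges H \<subseteq> edges G"

text \<open>As usual, the empty graph is not connected.\<close>

definition graph_connected :: "'a ugraph \<Rightarrow> bool" where
  "graph_connected G \<longleftrightarrow> verts G \<noteq> {} \<and>
     (\<forall>u\<in>verts G. \<forall>v\<in>verts G. (u, v) \<in> {(x, y). {x, y} \<in> edges G}\<^sup>*)"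

definition component :: "'a ugraph \<Rightarrow> 'a ugraph \<Rightarrow> bool" where
  "component G C \<longleftrightarrow> subgraph C G \<and> graph_connected C \<and>
     (\<forall>D. subgraph D G \<and> graph_connected D \<and> subgraph C D \<longrightarrow> D = C)"

definition delete_verts :: "'a ugraph \<Rightarrow> 'a set \<Rightarrow> 'a ugraph" where
  "delete_verts G S = \<lparr>verts = verts G - S, edges = {e \<in> edges G. e \<inter> S = {}}\<rparr>"

definition delete_edges :: "'a ugraph \<Rightarrow> 'a set set \<Rightarrow> 'a ugraph" where
  "delete_edges G F = \<lparr>verts = verts G, edges = edges G - F\<rparr>"

text \<open>A ray is a subgraph, not a sequence; the enumeration \<open>p\<close> of its vertices is
  determined by the subgraph, because \<open>p 0\<close> is its only vertex of degree one.\<close>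

definition rays :: "'a ugraph \<Rightarrow> 'a ugraph set" where
  "rays G = {R. subgraph R G \<and>
     (\<exists>p :: nat \<Rightarrow> 'a. inj p \<and> R = \<lparr>verts = range p, edges = range (\<lambda>i. {p i, p (Suc i)})\<rparr>)}"

definition tail :: "'a ugraph \<Rightarrow> 'a ugraph \<Rightarrow> bool" where
  "tail R T \<longleftrightarrow> subgraph T R \<and> graph_connected T \<and> infinite (verts T)"

definition tails_in_distinct_components ::
    "'a ugraph \<Rightarrow> 'a ugraph \<Rightarrow> 'a ugraph \<Rightarrow> bool" where
  "tails_in_distinct_components K r s \<longleftrightarrow>
     (\<exists>T U C D. tail r T \<and> tail s U \<and> component K C \<and> component K D \<and> C \<noteq> D \<and>
        subgraph T C \<and> subgraph U D)"

definition separates :: "'a ugraph \<Rightarrow> 'a set \<Rightarrow> 'a ugraph \<Rightarrow> 'a ugraph \<Rightarrow> bool" where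
  "separates G S r s \<longleftrightarrow> tails_in_distinct_components (delete_verts G S) r s"

definition edge_separates :: "'a ugraph \<Rightarrow> 'a set set \<Rightarrow> 'a ugraph \<Rightarrow> 'a ugraph \<Rightarrow> bool" where
  "edge_separates G F r s \<longleftrightarrow> tails_in_distinct_components (delete_edges G F) r s"

definition end_rel :: "'a ugraph \<Rightarrow> ('a ugraph \<times> 'a ugraph) set" where
  "end_rel G = {(r, s). r \<in> rays G \<and> s \<in> rays G \<and>
     \<not> (\<exists>S. finite S \<and> S \<subseteq> verts G \<and> separates G S r s)}"

definition edge_end_rel :: "'a ugraph \<Rightarrow> ('a ugraph \<times> 'a ugraph) set" where
  "edge_end_rel G = {(r, s). r \<in> rays G \<and> s \<in> rays G \<and>
     \<not> (\<exists>F. finite F \<and> F \<subseteq> edges G \<and> edge_separates G F r s)}"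

definition end_of :: "'a ugraph \<Rightarrow> 'a ugraph \<Rightarrow> 'a ugraph set" where
  "end_of G r = end_rel G `` {r}"

definition edge_end_of :: "'a ugraph \<Rightarrow> 'a ugraph \<Rightarrow> 'a ugraph set" where
  "edge_end_of G r = edge_end_rel G `` {r}"

definition end_nbhd :: "'a ugraph \<Rightarrow> 'a set \<Rightarrow> 'a ugraph \<Rightarrow> 'a ugraph set set" where
  "end_nbhd G S r = {end_of G s | s. s \<in> rays G \<and> \<not> separates G S r s}"

definition edge_end_nbhd :: "'a ugraph \<Rightarrow> 'a set set \<Rightarrow> 'a ugraph \<Rightarrow> 'a ugraph set set" where
  "edge_end_nbhd G F r = {edge_end_of G s | s. s \<in> rays G \<and> \<not> edge_separates G F r s}"

text \<open>In the two spaces of ends the generating sets form a base: \<open>s\<close> is not separated from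
  \<open>r\<close> by \<open>S\<close> iff both have tails in the same component, so \<open>end_nbhd G S r\<close> is a
  neighbourhood of each of its points. Since \<open>r\<close> is not separated from itself, the points of
  the spaces are exactly the classes of rays.\<close>

definition end_space :: "'a ugraph \<Rightarrow> 'a ugraph set topology" where
  "end_space G = topology_generated_by
     {end_nbhd G S r | S r. finite S \<and> S \<subseteq> verts G \<and> r \<in> rays G}"

definition edge_end_space :: "'a ugraph \<Rightarrow> 'a ugraph set topology" where
  "edge_end_space G = topology_generated_by
     {edge_end_nbhd G F r | F r. finite F \<and> F \<subseteq> edges G \<and> r \<in> rays G}"

text \<open>\<open>False\<close> and \<open>True\<close> play the roles of \<open>0\<close> and \<open>1\<close>. For a \<open>T\<^sub>1\<close> space, such as the
  Cantor set, the generating sets form a base.\<close>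

definition alexandroff_duplicate :: "'c topology \<Rightarrow> ('c \<times> bool) topology" where
  "alexandroff_duplicate X = topology_generated_by
     ({{(x, True)} | x. x \<in> topspace X} \<union>
      {U \<times> UNIV - {(x, True)} | U x. openin X U \<and> x \<in> U})"

definition cantor_set :: "(nat \<Rightarrow> bool) topology" where
  "cantor_set = product_topology (\<lambda>_. discrete_topology UNIV) UNIV"

text \<open>HOL cannot quantify existentially over types, so the graph with a prescribed end space
  must live on a fixed vertex type. This one has the cardinality of the continuum; the
  graph may use any set of its elements as vertices.\<close>

type_synonym continuum_vertex = "bool list + (nat \<Rightarrow> bool) \<times> nat"

end

theory Submission
  imports Defs
begin

text \<open>The end space in question comes from the binary tree in which every branch \<open>x\<close> gets a new
  vertex joined to all of its vertices, with a new ray attached. The new ray is isolated by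
  deleting its first vertex, but no finite set of other vertices separates it from \<open>x\<close>.

  With edge-ends this is impossible: whenever there are uncountably many isolated edge-ends in
  a component, a \<open>\<Delta>\<close>-system argument gives a vertex \<open>v\<close> and uncountably many of them such that
  every finite edge cut leaves all but countably many of these on the side of \<open>v\<close>. If \<open>(a, 0)\<close>
  is one of their condensation points, it lies on the side of \<open>v\<close> for every finite cut, so all
  its neighbourhoods contain all but countably many of them. As \<open>(a, 0)\<close> has a countable
  neighbourhood base, this leaves only countably many of them.\<close>


section \<open>Rays and connectedness\<close>

text \<open>The dominated tree itself shows what goes wrong with edges. Its root and every other
  vertex of a branch are joined to uncountably many vertices \<open>Inr (x, 0)\<close>, so no finite
  set of edges separates a branch from the root, and all branches fall into a single edge-end. A
  finite set of vertices may contain the root, whereas deleting edges never removes a vertex. In an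
  arbitrary graph \<open>v\<close> takes the place of the root: it is the start of all paths or an
  endpoint of an edge in the finite root of the \<Delta>-system, and having finitely many candidates
  is what lets one vertex serve uncountably many edge-ends.

  That the isolated edge-ends lie in one component costs nothing: the empty cut also defines a
  neighbourhood, so those close to one point \<open>(x, 0)\<close> share its component.

  Separation is defined through tails and components as subgraphs. It is reduced to reachability
  \<open>econn\<close> between two vertices, which depends on the edge set alone; therefore vertex
  cuts and edge cuts can be treated alike.\<close>

definition econn :: "'a set set \<Rightarrow> ('a \<times> 'a) set" where
  "econn E = {(x, y). {x, y} \<in> E}\<^sup>*"

lemma econn_refl [simp]: "(x, x) \<in> econn E"
  by (simp add: econn_def)

lemma econn_edge: "{x, y} \<in> E \<Longrightarrow> (x, y) \<in> econn E"
  by (auto simp: econn_def)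

lemma econn_trans: "(x, y) \<in> econn E \<Longrightarrow> (y, z) \<in> econn E \<Longrightarrow> (x, z) \<in> econn E"
  unfolding econn_def by (rule rtrancl_trans)

lemma econn_sym: "(x, y) \<in> econn E \<Longrightarrow> (y, x) \<in> econn E"
proof -
  have "sym {(x, y). {x, y} \<in> E}"
    by (auto simp: sym_def insert_commute)
  then show "(x, y) \<in> econn E \<Longrightarrow> (y, x) \<in> econn E"
    unfolding econn_def by (meson sym_rtrancl symD)
qed

lemma econn_mono: "(x, y) \<in> econn E \<Longrightarrow> E \<subseteq> E' \<Longrightarrow> (x, y) \<in> econn E'"
  unfolding econn_def using rtrancl_mono[of "{(x, y). {x, y} \<in> E}" "{(x, y). {x, y} \<in> E'}"]
  by blast

lemma econn_induct [consumes 1, case_names refl step]: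
  assumes "(x, y) \<in> econn E" "P x"
    "\<And>u v. (x, u) \<in> econn E \<Longrightarrow> {u, v} \<in> E \<Longrightarrow> P u \<Longrightarrow> P v"
  shows "P y"
  using assms(1)[unfolded econn_def]
  by (induction rule: rtrancl_induct) (use assms(2,3) in \<open>auto simp: econn_def\<close>)

text \<open>Used to bound the components that explicit cuts leave in the dominated tree.\<close>

lemma econn_closed:
  assumes "(u, v) \<in> econn E" "u \<in> W" "\<And>a b. {a, b} \<in> E \<Longrightarrow> a \<in> W \<Longrightarrow> b \<in> W"
  shows "v \<in> W"
  using assms by (induction rule: econn_induct) auto

text \<open>Follow the walk and restart at the far endpoint whenever it uses an edge of
  \<open>R\<close>. For a finite set \<open>R\<close> of edges this leaves finitely many possible
  starting vertices, as a later pigeonhole argument requires.\<close>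

lemma econn_avoiding:
  assumes "(u, w) \<in> econn P"
  shows "\<exists>v\<in>insert u (\<Union>R). (v, w) \<in> econn (P - R)"
  using assms
proof (induction rule: econn_induct)
  case (step w w')
  show ?case
  proof (cases "{w, w'} \<in> R")
    case True
    then show ?thesis by (intro bexI[of _ w']) auto
  next
    case False
    with step show ?thesis
      using econn_edge econn_trans by (metis DiffI)
  qed
qed auto

lemma econn_seq:
  assumes "\<And>i. N \<le> i \<Longrightarrow> {p i, p (Suc i)} \<in> E" "N \<le> j"
  shows "(p N, p j) \<in> econn E"
  using assms(2)
proof (induction j rule: dec_induct)
  case (step n)
  then show ?case using assms(1)[of n] econn_edge econn_trans by metis
qed simp

lemma econn_finite_edges:
  assumes "(x, y) \<in> econn E"
  obtains P where "finite P" "P \<subseteq> E" "(x, y) \<in> econn P"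
proof -
  have "\<exists>P. finite P \<and> P \<subseteq> E \<and> (x, y) \<in> econn P"
    using assms
  proof (induction rule: econn_induct)
    case refl
    then show ?case by (intro exI[of _ "{}"]) simp
  next
    case (step u v)
    then obtain P where P: "finite P" "P \<subseteq> E" "(x, u) \<in> econn P" by blast
    have "(x, u) \<in> econn (insert {u, v} P)"
      using econn_mono[OF P(3)] by blast
    then have "(x, v) \<in> econn (insert {u, v} P)"
      by (rule econn_trans) (simp add: econn_edge)
    with P step show ?case
      by (intro exI[of _ "insert {u, v} P"]) auto
  qed
  with that show thesis by blast
qed

section \<open>Rays as injective sequences\<close>

definition ray_seq :: "'a ugraph \<Rightarrow> (nat \<Rightarrow> 'a) \<Rightarrow> bool" where
  "ray_seq G p \<longleftrightarrow> inj p \<and> (\<forall>i. {p i, p (Suc i)} \<in> edges G)"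

definition ray_of :: "(nat \<Rightarrow> 'a) \<Rightarrow> 'a ugraph" where
  "ray_of p = \<lparr>verts = range p, edges = range (\<lambda>i. {p i, p (Suc i)})\<rparr>"

lemma rays_iff:
  assumes "simple_graph G"
  shows "r \<in> rays G \<longleftrightarrow> (\<exists>p. ray_seq G p \<and> r = ray_of p)"
proof
  assume "r \<in> rays G"
  then obtain p where "inj p" "r = ray_of p" "subgraph r G"
    by (auto simp: rays_def ray_of_def)
  then show "\<exists>p. ray_seq G p \<and> r = ray_of p"
    by (intro exI[of _ p]) (auto simp: ray_seq_def subgraph_def ray_of_def)
next
  assume "\<exists>p. ray_seq G p \<and> r = ray_of p"
  then obtain p where p: "inj p" "\<And>i. {p i, p (Suc i)} \<in> edges G" and r: "r = ray_of p"
    by (auto simp: ray_seq_def)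
  have "{p i, p (Suc i)} \<subseteq> verts G" for i
    using assms p(2)[of i] unfolding simple_graph_def by blast
  moreover have "p i \<noteq> p (Suc i)" for i
    using p(1) by (metis injD n_not_Suc_n)
  ultimately have "subgraph r G"
    using p(2) by (auto simp: subgraph_def r ray_of_def simple_graph_def)
  then show "r \<in> rays G"
    using p(1) by (auto simp: rays_def r ray_of_def)
qed

section \<open>Components as sets of reachable vertices\<close>

definition comp_of :: "'a ugraph \<Rightarrow> 'a \<Rightarrow> 'a ugraph" where
  "comp_of K w = \<lparr>verts = {u. (w, u) \<in> econn (edges K)},
     edges = {e \<in> edges K. e \<subseteq> {u. (w, u) \<in> econn (edges K)}}\<rparr>"

lemma econn_in_verts:
  assumes "simple_graph K" "w \<in> verts K" "(w, u) \<in> econn (edges K)"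
  shows "u \<in> verts K"
  using assms(3,2)
  by (induction rule: econn_induct) (use assms(1) in \<open>auto simp: simple_graph_def\<close>)

lemma connected_iff_econn:
  "graph_connected C \<longleftrightarrow> verts C \<noteq> {} \<and> (\<forall>u\<in>verts C. \<forall>v\<in>verts C. (u, v) \<in> econn (edges C))"
  by (simp add: graph_connected_def econn_def)

lemma subgraph_comp_of:
  assumes "simple_graph K" "subgraph C K" "graph_connected C" "w \<in> verts C"
  shows "subgraph C (comp_of K w)"
proof -
  have E: "edges C \<subseteq> edges K" and S: "simple_graph C"
    using assms(2) by (auto simp: subgraph_def)
  have "(w, u) \<in> econn (edges K)" if "u \<in> verts C" for u
    using assms(3,4) that E econn_mono by (metis connected_iff_econn)
  then show ?thesis
    using E S unfolding subgraph_def comp_of_def simple_graph_def by fastforce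
qed

lemma comp_of_subgraph:
  assumes "simple_graph K" "w \<in> verts K"
  shows "subgraph (comp_of K w) K"
  using assms econn_in_verts[OF assms]
  by (auto simp: subgraph_def comp_of_def simple_graph_def)

lemma comp_of_connected:
  "graph_connected (comp_of K w)"
proof -
  have "(w, u) \<in> econn (edges (comp_of K w))" if "(w, u) \<in> econn (edges K)" for u
    using that
  proof (induction rule: econn_induct)
    case (step u v)
    then have "{u, v} \<in> edges (comp_of K w)"
      using econn_edge[OF step(2)] econn_trans[OF step(1)] by (auto simp: comp_of_def)
    with step show ?case using econn_edge econn_trans by metis
  qed simp
  then have "(u, v) \<in> econn (edges (comp_of K w))"
    if "u \<in> verts (comp_of K w)" "v \<in> verts (comp_of K w)" for u v
    using econn_trans[OF econn_sym[of w u] , of _ v] that by (simp add: comp_of_def)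
  moreover have "w \<in> verts (comp_of K w)"
    by (simp add: comp_of_def)
  ultimately show ?thesis
    by (auto simp: connected_iff_econn)
qed

lemma component_iff:
  assumes "simple_graph K"
  shows "component K C \<longleftrightarrow> (\<exists>w\<in>verts K. C = comp_of K w)"
proof
  assume C: "component K C"
  then obtain w where w: "w \<in> verts C"
    by (auto simp: component_def graph_connected_def)
  then have "w \<in> verts K"
    using C by (auto simp: component_def subgraph_def)
  moreover have "subgraph C (comp_of K w)"
    using C w subgraph_comp_of[OF assms] by (auto simp: component_def)
  ultimately have "comp_of K w = C"
    using C comp_of_subgraph[OF assms \<open>w \<in> verts K\<close>] comp_of_connected[of K w]
    unfolding component_def by metis
  with \<open>w \<in> verts K\<close> show "\<exists>w\<in>verts K. C = comp_of K w" by blast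
next
  assume "\<exists>w\<in>verts K. C = comp_of K w"
  then obtain w where w: "w \<in> verts K" "C = comp_of K w" by blast
  have "D = C" if "subgraph D K" "graph_connected D" "subgraph C D" for D
  proof -
    have "w \<in> verts D"
      using that(3) w(2) by (auto simp: subgraph_def comp_of_def)
    then have "subgraph D C"
      using subgraph_comp_of[OF assms that(1,2)] w by simp
    with that(3) show ?thesis
      by (intro ugraph.equality) (auto simp: subgraph_def)
  qed
  with w show "component K C"
    using comp_of_subgraph[OF assms w(1)] comp_of_connected[of K w] unfolding component_def by blast
qed

section \<open>Tails, and separation as non-reachability\<close>

lemma tail_contains_cofinite:
  assumes "inj p" "tail (ray_of p) T"
  obtains k where "\<And>j. k \<le> j \<Longrightarrow> p j \<in> verts T"
proof -
  have E: "edges T \<subseteq> edges (ray_of p)" and V: "verts T \<subseteq> range p"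
    and S: "simple_graph T" and con: "graph_connected T" and inf: "infinite (verts T)"
    using assms(2) by (auto simp: tail_def subgraph_def ray_of_def)
  obtain k where k: "p k \<in> verts T"
    using inf V by (metis finite.emptyI imageE subset_eq equals0I)
  have "p j \<in> verts T" if "k \<le> j" for j
  proof (rule ccontr)
    assume j: "p j \<notin> verts T"
    \<comment> \<open>A walk in \<open>T\<close> moves along the ray by one index at a time, so from
      \<open>p k\<close> it cannot get past the missing vertex \<open>p j\<close>, and
      \<open>T\<close> would be finite.\<close>
    have "u \<in> p ` {..<j}" if "(p k, u) \<in> econn (edges T)" for u
      using that
    proof (induction rule: econn_induct)
      case refl
      have "k \<noteq> j" using j k by auto
      with \<open>k \<le> j\<close> show ?case by auto
    next
      case (step u v)
      then obtain i where i: "i < j" "u = p i" by auto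
      obtain l where l: "{u, v} = {p l, p (Suc l)}"
        using step(2) E by (auto simp: ray_of_def)
      have "v \<in> verts T"
        using step(2) S by (auto simp: simple_graph_def)
      then have "v \<noteq> p j" using j by auto
      with l i assms(1) show ?case
        by (auto simp: doubleton_eq_iff inj_eq less_Suc_eq)
    qed
    then have "verts T \<subseteq> p ` {..<j}"
      using con k by (auto simp: connected_iff_econn)
    then show False
      using inf finite_subset by blast
  qed
  with that show thesis by blast
qed

lemma ray_tail:
  assumes "simple_graph K" "inj p" "\<And>i. N \<le> i \<Longrightarrow> {p i, p (Suc i)} \<in> edges K"
  obtains T where "tail (ray_of p) T" "subgraph T (comp_of K (p N))"
proof -
  define T where "T = \<lparr>verts = p ` {N..}, edges = (\<lambda>i. {p i, p (Suc i)}) ` {N..}\<rparr>"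
  have sT: "simple_graph T"
    using assms(2) by (auto simp: simple_graph_def T_def inj_eq)
  have c: "(p N, p j) \<in> econn (edges T)" if "N \<le> j" for j
    by (rule econn_seq) (use that in \<open>auto simp: T_def\<close>)
  then have con: "graph_connected T"
    unfolding connected_iff_econn by (auto simp: T_def intro: econn_trans[OF econn_sym])
  have "infinite (verts T)"
    using assms(2) by (simp add: T_def finite_image_iff inj_on_subset infinite_Ici)
  then have "tail (ray_of p) T"
    using sT con by (auto simp: tail_def subgraph_def T_def ray_of_def)
  moreover have "subgraph T (comp_of K (p N))"
  proof (rule subgraph_comp_of[OF assms(1) _ con])
    have "p i \<in> verts K" if "N \<le> i" for i
      using assms(1) assms(3)[OF that] by (auto simp: simple_graph_def)
    then show "subgraph T K"
      using assms(3) sT by (auto simp: subgraph_def T_def)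
  qed (auto simp: T_def)
  ultimately show thesis by (rule that)
qed

text \<open>Every tail contains all far vertices of its ray, so whichever tails are chosen, their
  components are those of \<open>p N\<close> and \<open>q M\<close>. Any \<open>N\<close> and
  \<open>M\<close> beyond which the rays survive in \<open>K\<close> will do; later proofs use this
  freedom to pick convenient vertices.\<close>

lemma tails_in_distinct_components_iff:
  assumes "simple_graph K" "inj p" "inj q"
    and "\<And>i. N \<le> i \<Longrightarrow> {p i, p (Suc i)} \<in> edges K"
    and "\<And>i. M \<le> i \<Longrightarrow> {q i, q (Suc i)} \<in> edges K"
  shows "tails_in_distinct_components K (ray_of p) (ray_of q) \<longleftrightarrow> (p N, q M) \<notin> econn (edges K)"
proof
  assume "tails_in_distinct_components K (ray_of p) (ray_of q)"
  then obtain T U C D where tails: "tail (ray_of p) T" "tail (ray_of q) U"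
    and comps: "component K C" "component K D" "C \<noteq> D" and sub: "subgraph T C" "subgraph U D"
    unfolding tails_in_distinct_components_def by blast
  obtain c d where cd: "C = comp_of K c" "D = comp_of K d"
    using comps component_iff[OF assms(1)] by blast
  obtain k where k: "\<And>j. k \<le> j \<Longrightarrow> p j \<in> verts T"
    using tail_contains_cofinite[OF assms(2) tails(1)] by blast
  obtain l where l: "\<And>j. l \<le> j \<Longrightarrow> q j \<in> verts U"
    using tail_contains_cofinite[OF assms(3) tails(2)] by blast
  have "(c, p (max k N)) \<in> econn (edges K)" "(d, q (max l M)) \<in> econn (edges K)"
    using k[of "max k N"] l[of "max l M"] sub cd by (auto simp: subgraph_def comp_of_def)
  moreover have "(p N, p (max k N)) \<in> econn (edges K)" "(q M, q (max l M)) \<in> econn (edges K)"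
    using econn_seq assms(4,5) by (metis max.cobounded2)+
  ultimately have "(c, p N) \<in> econn (edges K)" "(q M, d) \<in> econn (edges K)"
    by (metis econn_sym econn_trans)+
  then have "(c, d) \<in> econn (edges K)" if "(p N, q M) \<in> econn (edges K)"
    using that econn_trans by metis
  moreover have "comp_of K c = comp_of K d" if "(c, d) \<in> econn (edges K)"
  proof -
    have "{u. (c, u) \<in> econn (edges K)} = {u. (d, u) \<in> econn (edges K)}"
      using econn_trans[OF that] econn_trans[OF econn_sym[OF that]] by blast
    then show ?thesis by (simp add: comp_of_def)
  qed
  ultimately show "(p N, q M) \<notin> econn (edges K)"
    using comps(3) cd by blast
next
  assume n: "(p N, q M) \<notin> econn (edges K)"
  obtain T where T: "tail (ray_of p) T" "subgraph T (comp_of K (p N))"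
    using ray_tail[OF assms(1,2,4)] by blast
  obtain U where U: "tail (ray_of q) U" "subgraph U (comp_of K (q M))"
    using ray_tail[OF assms(1,3,5)] by blast
  have "p N \<in> verts K" "q M \<in> verts K"
    using assms(1) assms(4)[of N] assms(5)[of M] by (auto simp: simple_graph_def)
  moreover have "comp_of K (p N) \<noteq> comp_of K (q M)"
  proof
    assume "comp_of K (p N) = comp_of K (q M)"
    then have "q M \<in> verts (comp_of K (p N))" by (simp add: comp_of_def)
    with n show False by (simp add: comp_of_def)
  qed
  ultimately show "tails_in_distinct_components K (ray_of p) (ray_of q)"
    unfolding tails_in_distinct_components_def
    using T U component_iff[OF assms(1)] by blast
qed

section \<open>End spaces\<close>

text \<open>Common frame of ends and edge-ends: \<open>I\<close> is the set of finite cuts and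
  \<open>K i\<close> is what the cut \<open>i\<close> leaves. \<open>directed\<close> stands for the
  union of two cuts, \<open>eventually_in\<close> for the fact that a finite cut meets a ray
  finitely often. Comparing edge sets is enough, as reachability sees nothing else.\<close>

locale end_system =
  fixes G :: "'a ugraph" and I :: "'i set" and K :: "'i \<Rightarrow> 'a ugraph"
  assumes simple: "simple_graph G" "\<And>i. i \<in> I \<Longrightarrow> simple_graph (K i)"
    and nonempty: "I \<noteq> {}"
    and directed: "\<And>i j. i \<in> I \<Longrightarrow> j \<in> I \<Longrightarrow> \<exists>k\<in>I. edges (K k) \<subseteq> edges (K i) \<inter> edges (K j)"
    and eventually_in: "\<And>i p. i \<in> I \<Longrightarrow> ray_seq G p \<Longrightarrow> \<exists>N. \<forall>n\<ge>N. {p n, p (Suc n)} \<in> edges (K i)"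
begin

definition together :: "'i \<Rightarrow> 'a ugraph \<Rightarrow> 'a ugraph \<Rightarrow> bool" where
  "together i r s \<longleftrightarrow> \<not> tails_in_distinct_components (K i) r s"

text \<open>The condition \<open>r \<in> rays G\<close> makes this agree with the image of
  \<open>{r}\<close> under the equivalence also when \<open>r\<close> is not a ray.\<close>

definition cls :: "'a ugraph \<Rightarrow> 'a ugraph set" where
  "cls r = {s. r \<in> rays G \<and> s \<in> rays G \<and> (\<forall>i\<in>I. together i r s)}"

definition nbhd :: "'i \<Rightarrow> 'a ugraph \<Rightarrow> 'a ugraph set set" where
  "nbhd i r = {cls s | s. s \<in> rays G \<and> together i r s}"

definition space :: "'a ugraph set topology" where
  "space = topology_generated_by {nbhd i r | i r. i \<in> I \<and> r \<in> rays G}"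

lemma together_iff:
  assumes "i \<in> I" "ray_seq G p" "ray_seq G q"
    and "\<And>n. N \<le> n \<Longrightarrow> {p n, p (Suc n)} \<in> edges (K i)"
    and "\<And>n. M \<le> n \<Longrightarrow> {q n, q (Suc n)} \<in> edges (K i)"
  shows "together i (ray_of p) (ray_of q) \<longleftrightarrow> (p N, q M) \<in> econn (edges (K i))"
  using tails_in_distinct_components_iff[of "K i" p q N M] simple assms
  by (auto simp: together_def ray_seq_def)

lemma ray_obtain:
  assumes "i \<in> I" "r \<in> rays G"
  obtains p N where "ray_seq G p" "r = ray_of p" "\<And>n. N \<le> n \<Longrightarrow> {p n, p (Suc n)} \<in> edges (K i)"
  using rays_iff[OF simple(1)] eventually_in assms by metis

lemma together_refl:
  assumes "i \<in> I" "r \<in> rays G"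
  shows "together i r r"
  using ray_obtain[OF assms] together_iff[OF assms(1)] econn_refl by metis

lemma together_sym:
  assumes "i \<in> I" "r \<in> rays G" "s \<in> rays G" "together i r s"
  shows "together i s r"
proof -
  obtain p N where p: "ray_seq G p" "r = ray_of p" "\<And>n. N \<le> n \<Longrightarrow> {p n, p (Suc n)} \<in> edges (K i)"
    using ray_obtain[OF assms(1,2)] by blast
  obtain q M where q: "ray_seq G q" "s = ray_of q" "\<And>n. M \<le> n \<Longrightarrow> {q n, q (Suc n)} \<in> edges (K i)"
    using ray_obtain[OF assms(1,3)] by blast
  show ?thesis
    using assms(4) together_iff[OF assms(1) p(1) q(1) p(3) q(3)]
      together_iff[OF assms(1) q(1) p(1) q(3) p(3)] p(2) q(2) econn_sym by metis
qed

lemma together_trans: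
  assumes "i \<in> I" "r \<in> rays G" "s \<in> rays G" "t \<in> rays G" "together i r s" "together i s t"
  shows "together i r t"
proof -
  obtain p N where p: "ray_seq G p" "r = ray_of p" "\<And>n. N \<le> n \<Longrightarrow> {p n, p (Suc n)} \<in> edges (K i)"
    using ray_obtain[OF assms(1,2)] by blast
  obtain q M where q: "ray_seq G q" "s = ray_of q" "\<And>n. M \<le> n \<Longrightarrow> {q n, q (Suc n)} \<in> edges (K i)"
    using ray_obtain[OF assms(1,3)] by blast
  obtain o' L where o: "ray_seq G o'" "t = ray_of o'" "\<And>n. L \<le> n \<Longrightarrow> {o' n, o' (Suc n)} \<in> edges (K i)"
    using ray_obtain[OF assms(1,4)] by blast
  show ?thesis
    using assms(5,6) together_iff[OF assms(1) p(1) q(1) p(3) q(3)]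
      together_iff[OF assms(1) q(1) o(1) q(3) o(3)] together_iff[OF assms(1) p(1) o(1) p(3) o(3)]
      p(2) q(2) o(2) econn_trans by metis
qed

lemma together_mono:
  assumes "i \<in> I" "k \<in> I" "edges (K k) \<subseteq> edges (K i)" "r \<in> rays G" "s \<in> rays G" "together k r s"
  shows "together i r s"
proof -
  obtain p N where p: "ray_seq G p" "r = ray_of p" "\<And>n. N \<le> n \<Longrightarrow> {p n, p (Suc n)} \<in> edges (K k)"
    using ray_obtain[OF assms(2,4)] by blast
  obtain q M where q: "ray_seq G q" "s = ray_of q" "\<And>n. M \<le> n \<Longrightarrow> {q n, q (Suc n)} \<in> edges (K k)"
    using ray_obtain[OF assms(2,5)] by blast
  have "(p N, q M) \<in> econn (edges (K k))"
    using assms(6) together_iff[OF assms(2) p(1) q(1) p(3) q(3)] p(2) q(2) by simp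
  then have "(p N, q M) \<in> econn (edges (K i))"
    by (rule econn_mono[OF _ assms(3)])
  then show ?thesis
    using together_iff[OF assms(1) p(1) q(1), of N M] p q assms(3) by blast
qed

lemma cls_eq_iff:
  assumes "r \<in> rays G" "s \<in> rays G"
  shows "cls r = cls s \<longleftrightarrow> (\<forall>i\<in>I. together i r s)"
proof
  assume "cls r = cls s"
  moreover have "s \<in> cls s"
    using assms together_refl by (simp add: cls_def)
  ultimately have "s \<in> cls r" by simp
  then show "\<forall>i\<in>I. together i r s"
    by (simp add: cls_def)
next
  assume "\<forall>i\<in>I. together i r s"
  then have "together i r t \<longleftrightarrow> together i s t" if "i \<in> I" "t \<in> rays G" for i t
    using assms that together_trans together_sym by metis
  then show "cls r = cls s"
    using assms by (auto simp: cls_def)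
qed

lemma cls_in_nbhd_iff:
  assumes "i \<in> I" "r \<in> rays G" "s \<in> rays G"
  shows "cls s \<in> nbhd i r \<longleftrightarrow> together i r s"
proof
  assume "cls s \<in> nbhd i r"
  then obtain t where t: "t \<in> rays G" "together i r t" "cls s = cls t"
    by (auto simp: nbhd_def)
  then have "together i t s"
    using cls_eq_iff[of t s] assms by auto
  then show "together i r s"
    using together_trans[OF assms(1,2) t(1) assms(3) t(2)] by blast
qed (use assms in \<open>auto simp: nbhd_def\<close>)

lemma openin_nbhd: "i \<in> I \<Longrightarrow> r \<in> rays G \<Longrightarrow> openin space (nbhd i r)"
  unfolding space_def by (rule topology_generated_by_Basis) blast

lemma topspace_space: "topspace space = cls ` rays G"
proof -
  obtain i where "i \<in> I" using nonempty by blast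
  then have "cls r \<in> nbhd i r" if "r \<in> rays G" for r
    using that together_refl cls_in_nbhd_iff by blast
  then have "cls ` rays G \<subseteq> topspace space"
    using \<open>i \<in> I\<close> openin_nbhd openin_subset by blast
  moreover have "topspace space \<subseteq> cls ` rays G"
    unfolding space_def topology_generated_by_topspace by (auto simp: nbhd_def)
  ultimately show ?thesis by blast
qed

text \<open>By transitivity of \<open>together i\<close>, a set \<open>nbhd i s\<close> contains
  \<open>nbhd i r\<close> for each of its points \<open>cls r\<close>; \<open>directed\<close> takes
  care of intersections.\<close>

lemma space_base:
  assumes "openin space U" "r \<in> rays G" "cls r \<in> U"
  obtains i where "i \<in> I" "nbhd i r \<subseteq> U"
proof -
  have "generate_topology_on {nbhd i r | i r. i \<in> I \<and> r \<in> rays G} U"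
    using assms(1) by (simp add: space_def openin_topology_generated_by_iff)
  then have "\<exists>i\<in>I. nbhd i r \<subseteq> U"
    using assms(3)
  proof (induction rule: generate_topology_on.induct)
    case Empty
    then show ?case by simp
  next
    case (Int a b)
    then obtain i j where ij: "i \<in> I" "nbhd i r \<subseteq> a" "j \<in> I" "nbhd j r \<subseteq> b" by blast
    obtain k where k: "k \<in> I" "edges (K k) \<subseteq> edges (K i) \<inter> edges (K j)"
      using directed ij by blast
    have "nbhd k r \<subseteq> nbhd l r" if "l \<in> I" "edges (K k) \<subseteq> edges (K l)" for l
      using together_mono[OF that(1) k(1) that(2) assms(2)] unfolding nbhd_def by blast
    then have "nbhd k r \<subseteq> nbhd i r" "nbhd k r \<subseteq> nbhd j r"
      using k ij by blast+
    with k ij show ?case by blast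
  next
    case (UN A)
    then show ?case by blast
  next
    case (Basis a)
    then obtain i s where a: "i \<in> I" "s \<in> rays G" "a = nbhd i s" by blast
    then have "together i s r"
      using Basis(2) cls_in_nbhd_iff assms(2) by blast
    then have "nbhd i r \<subseteq> a"
      using a assms(2) together_trans[of i s r] unfolding nbhd_def by blast
    with a show ?case by blast
  qed
  with that show thesis by blast
qed

end

section \<open>Finite edge cuts and finite vertex cuts as instances\<close>

lemma edges_delete_edges: "edges (delete_edges G F) = edges G - F"
  by (simp add: delete_edges_def)

lemma edges_delete_verts: "e \<in> edges (delete_verts G S) \<longleftrightarrow> e \<in> edges G \<and> e \<inter> S = {}"
  by (simp add: delete_verts_def)

lemma edge_end_system:
  assumes "simple_graph G"
  shows "end_system G {F. finite F \<and> F \<subseteq> edges G} (delete_edges G)"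
proof
  show "simple_graph G" by fact
  show "simple_graph (delete_edges G F)" for F
    using assms by (auto simp: simple_graph_def delete_edges_def)
  show "{F. finite F \<and> F \<subseteq> edges G} \<noteq> {}" by blast
  show "\<exists>k\<in>{F. finite F \<and> F \<subseteq> edges G}. edges (delete_edges G k)
      \<subseteq> edges (delete_edges G i) \<inter> edges (delete_edges G j)"
    if "i \<in> {F. finite F \<and> F \<subseteq> edges G}" "j \<in> {F. finite F \<and> F \<subseteq> edges G}" for i j
    by (rule bexI[of _ "i \<union> j"]) (use that in \<open>auto simp: delete_edges_def\<close>)
  show "\<exists>N. \<forall>n\<ge>N. {p n, p (Suc n)} \<in> edges (delete_edges G i)"
    if "i \<in> {F. finite F \<and> F \<subseteq> edges G}" "ray_seq G p" for i p
  proof -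
    \<comment> \<open>A ray uses each edge once, so a finite cut concerns finitely many
      indices.\<close>
    have "inj (\<lambda>n. {p n, p (Suc n)})"
      using that(2) by (force simp: inj_eq ray_seq_def doubleton_eq_iff intro: injI)
    then have "finite ((\<lambda>n. {p n, p (Suc n)}) -` i)"
      using that(1) finite_vimageI by blast
    then obtain N where "\<forall>n\<in>(\<lambda>n. {p n, p (Suc n)}) -` i. n < N"
      using finite_nat_set_iff_bounded by blast
    then show ?thesis
      using that(2) by (intro exI[of _ N]) (auto simp: delete_edges_def ray_seq_def dest: leD)
  qed
qed

lemma vertex_end_system:
  assumes "simple_graph G"
  shows "end_system G {S. finite S \<and> S \<subseteq> verts G} (delete_verts G)"
proof
  show "simple_graph G" by fact
  show "simple_graph (delete_verts G F)" for F
    using assms by (auto simp: simple_graph_def delete_verts_def)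
  show "{F. finite F \<and> F \<subseteq> verts G} \<noteq> {}" by blast
  show "\<exists>k\<in>{F. finite F \<and> F \<subseteq> verts G}. edges (delete_verts G k)
      \<subseteq> edges (delete_verts G i) \<inter> edges (delete_verts G j)"
    if "i \<in> {F. finite F \<and> F \<subseteq> verts G}" "j \<in> {F. finite F \<and> F \<subseteq> verts G}" for i j
    by (rule bexI[of _ "i \<union> j"]) (use that in \<open>auto simp: delete_verts_def\<close>)
  show "\<exists>N. \<forall>n\<ge>N. {p n, p (Suc n)} \<in> edges (delete_verts G i)"
    if "i \<in> {F. finite F \<and> F \<subseteq> verts G}" "ray_seq G p" for i p
  proof -
    have "finite (p -` i)"
      using that finite_vimageI by (auto simp: ray_seq_def)
    then obtain N where "\<forall>n\<in>p -` i. n < N"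
      using finite_nat_set_iff_bounded by blast
    then have "p n \<notin> i" if "N \<le> n" for n
      using that by (auto dest: leD)
    then show ?thesis
      using that(2) by (intro exI[of _ N]) (auto simp: delete_verts_def ray_seq_def)
  qed
qed

lemma edge_end_space_eq:
  assumes "simple_graph G"
  shows "edge_end_space G = end_system.space G {F. finite F \<and> F \<subseteq> edges G} (delete_edges G)"
proof -
  interpret end_system G "{F. finite F \<and> F \<subseteq> edges G}" "delete_edges G"
    by (rule edge_end_system[OF assms])
  have "edge_end_of G r = cls r" for r
    by (auto simp: edge_end_of_def edge_end_rel_def cls_def together_def edge_separates_def)
  then show ?thesis
    by (simp add: edge_end_space_def space_def edge_end_nbhd_def nbhd_def together_def
        edge_separates_def conj_assoc)
qed

lemma end_space_eq:
  assumes "simple_graph G"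
  shows "end_space G = end_system.space G {S. finite S \<and> S \<subseteq> verts G} (delete_verts G)"
proof -
  interpret end_system G "{S. finite S \<and> S \<subseteq> verts G}" "delete_verts G"
    by (rule vertex_end_system[OF assms])
  have "end_of G r = cls r" for r
    by (auto simp: end_of_def end_rel_def cls_def together_def separates_def)
  then show ?thesis
    by (simp add: end_space_def space_def end_nbhd_def nbhd_def together_def
        separates_def conj_assoc)
qed


section \<open>The duplicate of the Cantor set\<close>

text \<open>These words play two roles: they index the basic clopen sets of the Cantor set, and they
  are the vertices of the binary tree along the branch \<open>x\<close>.\<close>

definition seg :: "(nat \<Rightarrow> 'a) \<Rightarrow> nat \<Rightarrow> 'a list" where
  "seg x n = map x [0..<n]"

lemma length_seg [simp]: "length (seg x n) = n"
  by (simp add: seg_def)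

lemma seg_Suc: "seg x (Suc n) = seg x n @ [x n]"
  by (simp add: seg_def)

lemma seg_eq_iff: "seg x n = seg y n \<longleftrightarrow> (\<forall>i<n. x i = y i)"
  by (auto simp: seg_def)

lemma take_seg [simp]: "take m (seg x n) = seg x (min m n)"
  by (simp add: seg_def take_map take_upt min_def)

lemma seg_eq_all: "(\<And>n. seg x n = seg y n) \<Longrightarrow> x = y"
  by (metis ext lessI seg_eq_iff)

lemma openin_cantor_set_iff:
  "openin cantor_set U \<longleftrightarrow> (\<forall>x\<in>U. \<exists>n. \<forall>y. seg y n = seg x n \<longrightarrow> y \<in> U)"
proof
  assume U: "openin cantor_set U"
  show "\<forall>x\<in>U. \<exists>n. \<forall>y. seg y n = seg x n \<longrightarrow> y \<in> U"
  proof
    fix x assume "x \<in> U"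
    with U obtain B where B: "finite {i. B i \<noteq> UNIV}" "x \<in> Pi\<^sub>E UNIV B" "Pi\<^sub>E UNIV B \<subseteq> U"
      by (auto simp: cantor_set_def openin_product_topology_alt)
    then obtain n where n: "\<And>i. B i \<noteq> UNIV \<Longrightarrow> i < n"
      using finite_nat_set_iff_bounded by auto
    have "y \<in> Pi\<^sub>E UNIV B" if "seg y n = seg x n" for y
    proof -
      have "y i \<in> B i" for i
        using that n[of i] B(2) by (cases "B i = UNIV") (auto simp: seg_eq_iff PiE_iff)
      then show ?thesis by (simp add: PiE_iff)
    qed
    with B(3) show "\<exists>n. \<forall>y. seg y n = seg x n \<longrightarrow> y \<in> U" by blast
  qed
next
  assume U: "\<forall>x\<in>U. \<exists>n. \<forall>y. seg y n = seg x n \<longrightarrow> y \<in> U"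
  show "openin cantor_set U"
    unfolding cantor_set_def openin_product_topology_alt
  proof
    fix x assume "x \<in> U"
    with U obtain n where n: "\<And>y. seg y n = seg x n \<Longrightarrow> y \<in> U" by blast
    define B where "B i = (if i < n then {x i} else UNIV)" for i
    have "{i. B i \<noteq> UNIV} \<subseteq> {..<n}"
      by (auto simp: B_def)
    then have "finite {i. B i \<noteq> UNIV}"
      using finite_subset by blast
    moreover have "Pi\<^sub>E UNIV B \<subseteq> U"
      using n by (auto simp: PiE_iff B_def seg_eq_iff split: if_splits)
    ultimately show "\<exists>Ua. finite {i \<in> UNIV. Ua i \<noteq> topspace (discrete_topology UNIV)} \<and>
        (\<forall>i\<in>UNIV. openin (discrete_topology UNIV) (Ua i)) \<and> x \<in> Pi\<^sub>E UNIV Ua \<and> Pi\<^sub>E UNIV Ua \<subseteq> U"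
      by (intro exI[of _ B]) (auto simp: PiE_iff B_def)
  qed
qed

lemma topspace_cantor_set [simp]: "topspace cantor_set = UNIV"
  by (simp add: cantor_set_def PiE_UNIV_domain)

text \<open>Isolated points impose no condition. At \<open>(x, False)\<close> the cylinders
  punctured at \<open>(x, True)\<close> form a countable base, on which the counting argument for
  edge-ends relies.\<close>

lemma openin_alexandroff_duplicate_cantor_iff:
  "openin (alexandroff_duplicate cantor_set) W \<longleftrightarrow>
    (\<forall>x. (x, False) \<in> W \<longrightarrow>
      (\<exists>n. \<forall>y. seg y n = seg x n \<longrightarrow> (y, False) \<in> W \<and> (y \<noteq> x \<longrightarrow> (y, True) \<in> W)))"
    (is "_ \<longleftrightarrow> ?open W")
proof
  assume "openin (alexandroff_duplicate cantor_set) W"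
  then have "generate_topology_on
     ({{(x, True)} | x. x \<in> topspace cantor_set} \<union>
      {U \<times> UNIV - {(x, True)} | U x. openin cantor_set U \<and> x \<in> U}) W"
    by (simp add: alexandroff_duplicate_def openin_topology_generated_by_iff)
  then show "?open W"
  proof (induction rule: generate_topology_on.induct)
    case (Int a b)
    show ?case
    proof (intro allI impI)
      fix x assume x: "(x, False) \<in> a \<inter> b"
      obtain n where n: "\<And>y. seg y n = seg x n \<Longrightarrow> (y, False) \<in> a \<and> (y \<noteq> x \<longrightarrow> (y, True) \<in> a)"
        using Int(3) x by blast
      obtain m where m: "\<And>y. seg y m = seg x m \<Longrightarrow> (y, False) \<in> b \<and> (y \<noteq> x \<longrightarrow> (y, True) \<in> b)"
        using Int(4) x by blast
      show "\<exists>n. \<forall>y. seg y n = seg x n \<longrightarrow> (y, False) \<in> a \<inter> b \<and> (y \<noteq> x \<longrightarrow> (y, True) \<in> a \<inter> b)"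
      proof (intro exI[of _ "max n m"] allI impI)
        fix y assume "seg y (max n m) = seg x (max n m)"
        then have "seg y n = seg x n" "seg y m = seg x m"
          by (simp_all add: seg_eq_iff)
        with n m show "(y, False) \<in> a \<inter> b \<and> (y \<noteq> x \<longrightarrow> (y, True) \<in> a \<inter> b)"
          by blast
      qed
    qed
  next
    case (UN A)
    then show ?case by (meson UnionE UnionI)
  next
    case (Basis W)
    then show ?case
    proof
      assume "W \<in> {U \<times> UNIV - {(x, True)} | U x. openin cantor_set U \<and> x \<in> U}"
      then obtain U x where W: "W = U \<times> UNIV - {(x, True)}" "openin cantor_set U" by blast
      show ?thesis
      proof (intro allI impI)
        fix y assume "(y, False) \<in> W"
        then have "y \<in> U" using W by auto
        then obtain n where n: "\<And>z. seg z n = seg y n \<Longrightarrow> z \<in> U"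
          using W openin_cantor_set_iff by blast
        show "\<exists>n. \<forall>z. seg z n = seg y n \<longrightarrow> (z, False) \<in> W \<and> (z \<noteq> y \<longrightarrow> (z, True) \<in> W)"
        proof (cases "x = y")
          case True
          then show ?thesis using n W by auto
        next
          case False
          \<comment> \<open>A cylinder of length \<open>m\<close> around \<open>y\<close> misses
            \<open>x\<close>, so the point \<open>(x, True)\<close> removed from the generator does
            no harm there.\<close>
          then obtain m where m: "seg x m \<noteq> seg y m"
            using seg_eq_all by blast
          show ?thesis
          proof (intro exI[of _ "max n m"] allI impI)
            fix z assume "seg z (max n m) = seg y (max n m)"
            then have "seg z n = seg y n" "seg z m = seg y m"
              by (simp_all add: seg_eq_iff)
            then have "z \<in> U" "z \<noteq> x"
              using n m by auto
            then show "(z, False) \<in> W \<and> (z \<noteq> y \<longrightarrow> (z, True) \<in> W)"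
              using W by auto
          qed
        qed
      qed
    qed auto
  qed simp
next
  assume W: "?open W"
  show "openin (alexandroff_duplicate cantor_set) W"
  proof (subst openin_subopen, intro ballI)
    fix z assume z: "z \<in> W"
    obtain x b where zx: "z = (x, b)" by fastforce
    show "\<exists>T. openin (alexandroff_duplicate cantor_set) T \<and> z \<in> T \<and> T \<subseteq> W"
    proof (cases b)
      case True
      have "openin (alexandroff_duplicate cantor_set) {(x, True)}"
        unfolding alexandroff_duplicate_def by (rule topology_generated_by_Basis) simp
      with z zx True show ?thesis by (intro exI[of _ "{(x, True)}"]) simp
    next
      case False
      then have "(x, False) \<in> W" using z zx by simp
      with W obtain n where
        n: "\<And>y. seg y n = seg x n \<Longrightarrow> (y, False) \<in> W \<and> (y \<noteq> x \<longrightarrow> (y, True) \<in> W)"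
        by metis
      define U where "U = {y. seg y n = seg x n}"
      have "openin cantor_set U"
        unfolding openin_cantor_set_iff U_def by (intro ballI exI[of _ n]) simp
      moreover have "x \<in> U"
        by (simp add: U_def)
      ultimately have "openin (alexandroff_duplicate cantor_set) (U \<times> UNIV - {(x, True)})"
        unfolding alexandroff_duplicate_def by (intro topology_generated_by_Basis) blast
      moreover have "U \<times> UNIV - {(x, True)} \<subseteq> W"
      proof
        fix w assume w: "w \<in> U \<times> UNIV - {(x, True)}"
        obtain y c where y: "w = (y, c)" by fastforce
        with w have "seg y n = seg x n" "c \<Longrightarrow> y \<noteq> x"
          by (auto simp: U_def)
        with n[of y] y show "w \<in> W" by (cases c) simp_all
      qed
      ultimately show ?thesis
        using \<open>x \<in> U\<close> zx False by (intro exI[of _ "U \<times> UNIV - {(x, True)}"]) simp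
    qed
  qed
qed

lemma topspace_alexandroff_duplicate_cantor [simp]:
  "topspace (alexandroff_duplicate cantor_set) = UNIV"
proof -
  have "openin (alexandroff_duplicate cantor_set) UNIV"
    by (simp add: openin_alexandroff_duplicate_cantor_iff)
  then show ?thesis
    using openin_subset by blast
qed

section \<open>A graph with the duplicate as its end space\<close>

text \<open>The infinite binary tree, and for each of its branches \<open>x\<close> a new ray \<open>Inr (x, 0),
  Inr (x, 1), \<dots>\<close> whose first vertex dominates \<open>x\<close>, being joined to all vertices of the branch.\<close>

definition dominated_tree :: "continuum_vertex ugraph" where
  "dominated_tree = \<lparr>verts = UNIV,
     edges = {{Inl s, Inl (s @ [b])} | s b. True} \<union> {{Inr (x, n), Inr (x, Suc n)} | x n. True}
       \<union> {{Inr (x, 0), Inl (seg x n)} | x n. True}\<rparr>"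

lemma simple_dominated_tree: "simple_graph dominated_tree"
  by (auto simp: simple_graph_def dominated_tree_def)

lemma verts_dominated_tree [simp]: "verts dominated_tree = UNIV"
  by (simp add: dominated_tree_def)

lemma edge_Inl_iff:
  "{Inl s, v} \<in> edges dominated_tree \<longleftrightarrow>
    (\<exists>b. v = Inl (s @ [b])) \<or> (\<exists>t b. s = t @ [b] \<and> v = Inl t) \<or> (\<exists>x n. s = seg x n \<and> v = Inr (x, 0))"
  by (auto simp: dominated_tree_def doubleton_eq_iff)

lemma edge_Inr_iff:
  "{Inr (x, n), v} \<in> edges dominated_tree \<longleftrightarrow>
    v = Inr (x, Suc n) \<or> (\<exists>m. n = Suc m \<and> v = Inr (x, m)) \<or> (n = 0 \<and> (\<exists>m. v = Inl (seg x m)))"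
  by (auto simp: dominated_tree_def doubleton_eq_iff)

section \<open>Standard rays and their separation by finite vertex sets\<close>

fun std_seq :: "(nat \<Rightarrow> bool) \<times> bool \<Rightarrow> nat \<Rightarrow> continuum_vertex" where
  "std_seq (x, False) i = Inl (seg x i)"
| "std_seq (x, True) i = Inr (x, i)"

lemma ray_seq_std: "ray_seq dominated_tree (std_seq z)"
proof -
  obtain x b where z: "z = (x, b)" by fastforce
  have "inj (\<lambda>i. seg x i)"
    by (rule injI) (metis length_seg)
  with z show ?thesis
    by (cases b) (auto simp: ray_seq_def inj_def edge_Inl_iff edge_Inr_iff seg_Suc)
qed

interpretation dt: end_system dominated_tree "Collect finite" "delete_verts dominated_tree"
  using vertex_end_system[OF simple_dominated_tree] by simp

abbreviation std_ray :: "(nat \<Rightarrow> bool) \<times> bool \<Rightarrow> continuum_vertex ugraph" where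
  "std_ray z \<equiv> ray_of (std_seq z)"

lemma std_ray_in_rays: "std_ray z \<in> rays dominated_tree"
  using ray_seq_std rays_iff[OF simple_dominated_tree] by blast

text \<open>Without \<open>Inr (x, 0)\<close>, the rest of the new ray has no neighbours outside
  itself.\<close>

lemma separate_new_ray:
  assumes "dt.together {Inr (x, 0)} (std_ray (x, True)) (std_ray z)"
  shows "z = (x, True)"
proof -
  let ?K = "delete_verts dominated_tree {Inr (x, 0)}"
  \<comment> \<open>Index 1 skips the deleted vertex, the first one of the ray of
    \<open>(x, True)\<close>.\<close>
  have E: "{std_seq z n, std_seq z (Suc n)} \<in> edges ?K" if "1 \<le> n" for z n
    using ray_seq_std[of z] that
    by (cases z; cases "snd z") (auto simp: edges_delete_verts ray_seq_def)
  have "(std_seq (x, True) 1, std_seq z 1) \<in> econn (edges ?K)"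
    by (rule dt.together_iff[THEN iffD1, OF _ _ _ _ _ assms]; (erule E | rule ray_seq_std | simp))
  then have "std_seq z 1 \<in> {Inr (x, Suc k) | k. True}"
    by (rule econn_closed) (auto simp: edges_delete_verts edge_Inr_iff gr0_conv_Suc)
  then show ?thesis
    by (cases z; cases "snd z") auto
qed

text \<open>The cut behind a punctured cylinder. Deleting the levels below \<open>n\<close> leaves
  disjoint subtrees over the words of length \<open>n\<close>, and a vertex
  \<open>Inr (u, 0)\<close> does not link two of them, since it is joined only to the branch
  \<open>u\<close>. Deleting \<open>Inr (x, 0)\<close> removes the single point
  \<open>(x, True)\<close>.\<close>

definition initial_cut :: "(nat \<Rightarrow> bool) \<Rightarrow> nat \<Rightarrow> continuum_vertex set" where
  "initial_cut x n = insert (Inr (x, 0)) (Inl ` {s. length s < n})"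

lemma finite_initial_cut: "finite (initial_cut x n)"
proof -
  have "{s :: bool list. length s < n} \<subseteq> {s. set s \<subseteq> UNIV \<and> length s \<le> n}"
    by auto
  then have "finite {s :: bool list. length s < n}"
    by (rule finite_subset) (rule finite_lists_length_le, simp)
  then show ?thesis by (simp add: initial_cut_def)
qed

lemma separate_branch:
  assumes "dt.together (initial_cut x n) (std_ray (y, False)) (std_ray z)"
  shows "seg (fst z) n = seg y n \<and> z \<noteq> (x, True)"
proof -
  let ?K = "delete_verts dominated_tree (initial_cut x n)"
  \<comment> \<open>From index \<open>Suc n\<close> on, a branch is above the deleted levels and a
    new ray has left \<open>Inr (x, 0)\<close> behind, also when \<open>n = 0\<close>.\<close>
  have E: "{std_seq z m, std_seq z (Suc m)} \<in> edges ?K" if "Suc n \<le> m" for z m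
    using ray_seq_std[of z] that
    by (cases z; cases "snd z") (auto simp: edges_delete_verts ray_seq_def initial_cut_def)
  \<comment> \<open>The subtree over \<open>seg y n\<close> together with the new rays attached to
    its branches, except the one at \<open>x\<close>, whose only link to the tree is
    deleted.\<close>
  define W :: "continuum_vertex set" where
    "W = {Inl s | s. n \<le> length s \<and> take n s = seg y n} \<union> {Inr (z, k) | z k. seg z n = seg y n \<and> z \<noteq> x}"
  have "(std_seq (y, False) (Suc n), std_seq z (Suc n)) \<in> econn (edges ?K)"
    by (rule dt.together_iff[THEN iffD1, OF _ _ _ _ _ assms];
        (erule E | rule ray_seq_std | simp add: finite_initial_cut))
  then have "std_seq z (Suc n) \<in> W"
  proof (rule econn_closed)
    show "std_seq (y, False) (Suc n) \<in> W"
      by (simp add: W_def min_def)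
    fix a b assume ab: "{a, b} \<in> edges ?K" "a \<in> W"
    then have e: "{a, b} \<in> edges dominated_tree" and b: "b \<notin> initial_cut x n"
      by (auto simp: edges_delete_verts)
    from ab(2) consider (tree) s where "a = Inl s" "n \<le> length s" "take n s = seg y n"
      | (top) z k where "a = Inr (z, k)" "seg z n = seg y n" "z \<noteq> x"
      by (auto simp: W_def)
    then show "b \<in> W"
    proof cases
      case tree
      with e consider (up) c where "b = Inl (s @ [c])" | (down) t c where "s = t @ [c]" "b = Inl t"
        | (side) z m where "s = seg z m" "b = Inr (z, 0)"
        by (auto simp: edge_Inl_iff)
      then show ?thesis
      proof cases
        case up
        with tree show ?thesis by (simp add: W_def)
      next
        case down
        with b have "n \<le> length t" by (auto simp: initial_cut_def)
        with down tree show ?thesis by (simp add: W_def)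
      next
        case side
        with b have "z \<noteq> x" by (auto simp: initial_cut_def)
        with side tree show ?thesis by (simp add: W_def min_def)
      qed
    next
      case top
      with e consider "b = Inr (z, Suc k)" | m where "b = Inr (z, m)" | m where "b = Inl (seg z m)"
        by (auto simp: edge_Inr_iff)
      then show ?thesis
      proof cases
        case (3 m)
        with b have "n \<le> m" by (auto simp: initial_cut_def)
        with 3 top show ?thesis by (simp add: W_def min_def)
      qed (use top in \<open>simp_all add: W_def\<close>)
    qed
  qed
  moreover obtain u c where "z = (u, c)" by fastforce
  ultimately show ?thesis
    by (cases c) (auto simp: W_def min_def)
qed

lemma finite_length_bound:
  assumes "finite S"
  obtains n where "\<And>t. n \<le> length t \<Longrightarrow> Inl t \<notin> S"
proof -
  have "finite (length ` (Inl -` S))"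
    using assms finite_vimageI[OF assms, of Inl] by simp
  then obtain n where "\<forall>k \<in> length ` (Inl -` S). k < n"
    using finite_nat_set_iff_bounded by metis
  with that show thesis
    by (metis image_eqI vimageI leD)
qed

text \<open>Above the longest word in \<open>S\<close> the tree is intact, so branches that agree up
  to such a level \<open>n\<close> remain together. Their common vertex \<open>seg x n\<close> is
  also adjacent to \<open>Inr (y, 0)\<close>, which leads into the new ray at \<open>y\<close> if
  \<open>S\<close> misses it.\<close>

lemma branch_nbhd:
  assumes "finite S"
  obtains n where "\<And>y b. seg y n = seg x n \<Longrightarrow> (b \<Longrightarrow> \<forall>k. Inr (y, k) \<notin> S) \<Longrightarrow>
    dt.together S (std_ray (x, False)) (std_ray (y, b))"
proof -
  let ?K = "delete_verts dominated_tree S"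
  obtain n where n: "\<And>t. n \<le> length t \<Longrightarrow> Inl t \<notin> S"
    using finite_length_bound[OF assms] by blast
  have "dt.together S (std_ray (x, False)) (std_ray (y, b))"
    if y: "seg y n = seg x n" "b \<Longrightarrow> \<forall>k. Inr (y, k) \<notin> S" for y b
  proof -
    have branch: "{std_seq (z, False) m, std_seq (z, False) (Suc m)} \<in> edges ?K" if "n \<le> m" for z m
      using ray_seq_std[of "(z, False)"] that n[of "seg z m"] n[of "seg z (Suc m)"]
      by (auto simp: edges_delete_verts ray_seq_def)
    have S: "S \<in> Collect finite"
      using assms by simp
    show ?thesis
    proof (cases b)
      case False
      then show ?thesis
        using dt.together_iff[OF S ray_seq_std ray_seq_std, of n "(x, False)" n "(y, False)"]
          branch y by simp
    next
      case True
      have new: "{std_seq (y, True) m, std_seq (y, True) (Suc m)} \<in> edges ?K" if "0 \<le> m" for m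
        using ray_seq_std[of "(y, True)"] y True by (auto simp: edges_delete_verts ray_seq_def)
      have "{Inl (seg x n), Inr (y, 0)} \<in> edges ?K"
        using y True n[of "seg x n"] y(1)[symmetric] by (auto simp: edges_delete_verts edge_Inl_iff)
      then have "(std_seq (x, False) n, std_seq (y, True) 0) \<in> econn (edges ?K)"
        by (simp add: econn_edge)
      then show ?thesis
        using dt.together_iff[OF S ray_seq_std ray_seq_std, of n "(x, False)" 0 "(y, True)"]
          branch new True by simp
    qed
  qed
  with that show thesis by blast
qed

section \<open>Every ray is equivalent to a standard one\<close>

lemma binary_Koenig:
  fixes L :: "bool list set"
  assumes "infinite L"
  obtains x where "\<And>n. infinite {s \<in> L. take n s = seg x n}"
proof -
  let ?P = "\<lambda>n t. length t = n \<and> infinite {s \<in> L. take n s = t}"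
  have "\<exists>f. \<forall>n. ?P n (f n) \<and> (\<exists>b. f (Suc n) = f n @ [b])"
  proof (rule dependent_nat_choice)
    show "\<exists>t. ?P 0 t"
      using assms by simp
    fix t n assume t: "?P n t"
    \<comment> \<open>\<open>L\<close> is not assumed closed under prefixes. Apart from words that
      extend one of the two successors of \<open>t\<close>, only \<open>t\<close> itself begins with
      \<open>t\<close>, so one successor keeps infinitely many words.\<close>
    have "{s \<in> L. take n s = t} \<subseteq>
        {t} \<union> {s \<in> L. take (Suc n) s = t @ [True]} \<union> {s \<in> L. take (Suc n) s = t @ [False]}"
    proof
      fix s assume s: "s \<in> {s \<in> L. take n s = t}"
      show "s \<in> {t} \<union> {s \<in> L. take (Suc n) s = t @ [True]} \<union> {s \<in> L. take (Suc n) s = t @ [False]}"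
      proof (cases "length s \<le> n")
        case False
        then have "take (Suc n) s = t @ [s ! n]"
          using s by (simp add: take_Suc_conv_app_nth)
        with s show ?thesis by (cases "s ! n") auto
      qed (use s in simp)
    qed
    with t have "infinite {s \<in> L. take (Suc n) s = t @ [True]} \<or>
        infinite {s \<in> L. take (Suc n) s = t @ [False]}"
      by (auto dest: finite_subset)
    then obtain b where "infinite {s \<in> L. take (Suc n) s = t @ [b]}"
      by blast
    with t show "\<exists>u. ?P (Suc n) u \<and> (\<exists>b. u = t @ [b])"
      by (intro exI[of _ "t @ [b]"]) auto
  qed
  then obtain f where f: "\<And>n. length (f n) = n" "\<And>n. infinite {s \<in> L. take n s = f n}"
    "\<And>n. \<exists>b. f (Suc n) = f n @ [b]" by blast
  define x where "x n = f (Suc n) ! n" for n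
  have "f n = seg x n" for n
  proof (induction n)
    case 0
    show ?case using f(1)[of 0] by (simp add: seg_def)
  next
    case (Suc n)
    obtain b where b: "f (Suc n) = f n @ [b]" using f(3) by blast
    then have "x n = b"
      using f(1)[of n] by (simp add: x_def nth_append)
    with b Suc show ?case by (simp add: seg_Suc)
  qed
  with that f(2) show thesis by metis
qed

lemma econn_take:
  assumes "n \<le> m" "m \<le> length s" "\<And>t. n \<le> length t \<Longrightarrow> Inl t \<notin> S"
  shows "(Inl (take n s), Inl (take m s)) \<in> econn (edges (delete_verts dominated_tree S))"
  using assms(1,2)
proof (induction m rule: dec_induct)
  case (step m)
  then have "take (Suc m) s = take m s @ [s ! m]"
    by (simp add: take_Suc_conv_app_nth)
  moreover have "Inl (take m s) \<notin> S" "Inl (take m s @ [s ! m]) \<notin> S"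
    using step assms(3) by simp_all
  ultimately have "{Inl (take m s), Inl (take (Suc m) s)} \<in> edges (delete_verts dominated_tree S)"
    by (simp add: edges_delete_verts edge_Inl_iff)
  with step show ?case
    using econn_trans econn_edge by (metis Suc_leD)
qed simp

text \<open>A new ray has no exit beyond its first vertex: after one step upwards an injective
  sequence cannot turn back and must follow it forever.\<close>

lemma new_ray_if_ascending:
  assumes p: "ray_seq dominated_tree p" and i: "p i = Inr (x, k)" "p (Suc i) = Inr (x, Suc k)"
    and S: "finite S"
  shows "dt.together S (ray_of p) (std_ray (x, True))"
proof -
  have asc: "p (i + j) = Inr (x, k + j) \<and> p (Suc (i + j)) = Inr (x, Suc (k + j))" for j
  proof (induction j)
    case (Suc j)
    have "{Inr (x, Suc (k + j)), p (Suc (Suc (i + j)))} \<in> edges dominated_tree"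
      using p Suc unfolding ray_seq_def by metis
    moreover have "p (Suc (Suc (i + j))) \<noteq> p (i + j)"
      using p by (simp add: ray_seq_def inj_eq)
    ultimately show ?case
      using Suc by (auto simp: edge_Inr_iff)
  qed (use i in simp)
  have S': "S \<in> Collect finite"
    using S by simp
  obtain N where N: "\<And>n. N \<le> n \<Longrightarrow> {p n, p (Suc n)} \<in> edges (delete_verts dominated_tree S)"
    using dt.eventually_in[OF S' p] by blast
  obtain M where M: "\<And>n. M \<le> n \<Longrightarrow>
      {std_seq (x, True) n, std_seq (x, True) (Suc n)} \<in> edges (delete_verts dominated_tree S)"
    using dt.eventually_in[OF S' ray_seq_std] by blast
  \<comment> \<open>This puts both indices past their bounds, while \<open>asc\<close> still makes
    the two vertices equal.\<close>
  let ?j = "N + M"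
  have "dt.together S (ray_of p) (std_ray (x, True)) \<longleftrightarrow>
      (p (i + ?j), std_seq (x, True) (k + ?j)) \<in> econn (edges (delete_verts dominated_tree S))"
    by (rule dt.together_iff[OF S' p ray_seq_std]) (rule N M; linarith)+
  with asc[of ?j] show ?thesis by simp
qed

text \<open>On a new ray such a sequence can only descend, so it returns to the tree again and again
  and visits infinitely many words. A branch \<open>x\<close> at which these words accumulate
  represents its end, since a visited word over \<open>seg x n\<close> is joined to
  \<open>seg x n\<close> within the tree.\<close>

lemma branch_if_not_ascending:
  assumes p: "ray_seq dominated_tree p"
    and desc: "\<And>i x k. p i = Inr (x, k) \<Longrightarrow> p (Suc i) \<noteq> Inr (x, Suc k)"
  obtains x where "\<And>S. finite S \<Longrightarrow> dt.together S (ray_of p) (std_ray (x, False))"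
proof -
  have inj: "inj p" using p by (simp add: ray_seq_def)
  have tree: "\<exists>i\<ge>N. \<exists>s. p i = Inl s" for N
  proof (rule ccontr)
    assume "\<not> (\<exists>i\<ge>N. \<exists>s. p i = Inl s)"
    then have top: "\<exists>y. p i = Inr y" if "N \<le> i" for i
      using that by (metis sum.exhaust)
    obtain x k where xk: "p N = Inr (x, k)"
      using top by fastforce
    have step: "\<exists>m. l = Suc m \<and> p (Suc i) = Inr (x, m)" if "N \<le> i" "p i = Inr (x, l)" for i l
    proof -
      have "{Inr (x, l), p (Suc i)} \<in> edges dominated_tree"
        using p that(2) unfolding ray_seq_def by metis
      then show ?thesis
        using desc[OF that(2)] top[of "Suc i"] that(1) by (auto simp: edge_Inr_iff)
    qed
    \<comment> \<open>The height drops by one with each step, so there are at most \<open>k\<close>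
      steps.\<close>
    have "\<exists>m. p (N + j) = Inr (x, m) \<and> m + j = k" for j
    proof (induction j)
      case (Suc j)
      then show ?case using step[of "N + j"] by fastforce
    qed (use xk in simp)
    from this[of "Suc k"] show False by simp
  qed
  define L where "L = {s. \<exists>i. p i = Inl s}"
  have "infinite L"
  proof
    assume "finite L"
    then have "finite (p -` (Inl ` L))"
      by (intro finite_vimageI inj) simp
    then obtain N where "\<forall>i \<in> p -` (Inl ` L). i < N"
      using finite_nat_set_iff_bounded by blast
    moreover obtain i s where "i \<ge> N" "p i = Inl s"
      using tree by blast
    ultimately show False
      by (auto simp: L_def dest: leD)
  qed
  then obtain x where x: "\<And>n. infinite {s \<in> L. take n s = seg x n}"
    using binary_Koenig by blast
  have "dt.together S (ray_of p) (std_ray (x, False))" if fin: "finite S" for S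
  proof -
    let ?E = "edges (delete_verts dominated_tree S)"
    have S': "S \<in> Collect finite"
      using fin by simp
    obtain n where n: "\<And>t. n \<le> length t \<Longrightarrow> Inl t \<notin> S"
      using finite_length_bound[OF fin] by blast
    obtain N where N: "\<And>n. N \<le> n \<Longrightarrow> {p n, p (Suc n)} \<in> ?E"
      using dt.eventually_in[OF S' p] by blast
    \<comment> \<open>Infinitely many visited words lie over \<open>seg x n\<close>, so one of them
      is visited at an index \<open>i \<ge> N\<close>, from which on the ray avoids
      \<open>S\<close>.\<close>
    have "finite {s. Inl s \<in> p ` {..<N}}"
      using finite_vimageI[of "p ` {..<N}" Inl] by (simp add: vimage_def)
    with x[of n] have "\<not> {s \<in> L. take n s = seg x n} \<subseteq> {s. Inl s \<in> p ` {..<N}}"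
      by (auto dest: finite_subset)
    then obtain s where s: "s \<in> L" "take n s = seg x n" "Inl s \<notin> p ` {..<N}"
      by blast
    then obtain i where i: "p i = Inl s"
      by (auto simp: L_def)
    have "N \<le> i"
      using s(3) i by (metis imageI lessThan_iff not_less)
    have "n \<le> length s"
      using arg_cong[OF s(2), of length] by simp
    then have "(Inl (seg x n), Inl s) \<in> econn ?E"
      using econn_take[of n "length s" s S] n s(2) by simp
    then have "(p i, std_seq (x, False) n) \<in> econn ?E"
      using i by (simp add: econn_sym)
    moreover have "{std_seq (x, False) m, std_seq (x, False) (Suc m)} \<in> ?E" if "n \<le> m" for m
      using ray_seq_std[of "(x, False)"] that n[of "seg x m"] n[of "seg x (Suc m)"]
      by (auto simp: edges_delete_verts ray_seq_def)
    moreover have "{p m, p (Suc m)} \<in> ?E" if "i \<le> m" for m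
      using N \<open>N \<le> i\<close> that by simp
    ultimately show ?thesis
      using dt.together_iff[OF S' p ray_seq_std, of i n "(x, False)"] by metis
  qed
  with that show thesis by blast
qed

lemma rays_equiv_std:
  assumes "r \<in> rays dominated_tree"
  shows "\<exists>z. dt.cls r = dt.cls (std_ray z)"
proof -
  obtain p where p: "ray_seq dominated_tree p" "r = ray_of p"
    using assms rays_iff[OF simple_dominated_tree] by blast
  have "\<exists>z. \<forall>S. finite S \<longrightarrow> dt.together S r (std_ray z)"
  proof (cases "\<exists>i x k. p i = Inr (x, k) \<and> p (Suc i) = Inr (x, Suc k)")
    case True
    then show ?thesis using new_ray_if_ascending[OF p(1)] p(2) by blast
  next
    case False
    then obtain x where "\<And>S. finite S \<Longrightarrow> dt.together S (ray_of p) (std_ray (x, False))"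
      using branch_if_not_ascending[OF p(1)] by metis
    with p(2) show ?thesis by blast
  qed
  then obtain z where "\<forall>S\<in>Collect finite. dt.together S r (std_ray z)"
    by auto
  then have "dt.cls r = dt.cls (std_ray z)"
    by (simp only: dt.cls_eq_iff[OF assms std_ray_in_rays])
  then show ?thesis ..
qed

section \<open>The homeomorphism onto the end space\<close>

lemma finite_separated_from:
  assumes "finite Y"
  shows "\<exists>n. \<forall>y\<in>Y. seg y n = seg x n \<longrightarrow> y = x"
  using assms
proof (induction Y)
  case (insert z Y)
  then obtain n where n: "\<forall>y\<in>Y. seg y n = seg x n \<longrightarrow> y = x" by blast
  obtain m where m: "seg z m = seg x m \<Longrightarrow> z = x"
    using seg_eq_all by blast
  show ?case
  proof (intro exI[of _ "max n m"] ballI impI)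
    fix y assume y: "y \<in> insert z Y" "seg y (max n m) = seg x (max n m)"
    then have "seg y n = seg x n" "seg y m = seg x m"
      by (simp_all add: seg_eq_iff)
    with y n m show "y = x" by blast
  qed
qed simp

lemma homeomorphic_dominated_tree:
  "alexandroff_duplicate cantor_set homeomorphic_space end_space dominated_tree"
proof -
  define f where "f z = dt.cls (std_ray z)" for z
  have in_nbhd: "f z \<in> dt.nbhd S r \<longleftrightarrow> dt.together S r (std_ray z)"
    if "finite S" "r \<in> rays dominated_tree" for z S r
    using that dt.cls_in_nbhd_iff std_ray_in_rays by (simp add: f_def)
  have topspace: "topspace dt.space = range f"
    unfolding dt.topspace_space f_def using rays_equiv_std std_ray_in_rays by blast
  have nbhd_sub: "dt.nbhd S r \<subseteq> range f" if "finite S" "r \<in> rays dominated_tree" for S r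
    using dt.openin_nbhd[of S r] that openin_subset topspace by fastforce
  have together: "dt.together S (std_ray z) (std_ray w)" if "f z = f w" "finite S" for z w S
    using that dt.cls_eq_iff std_ray_in_rays by (simp add: f_def)
  have inj: "inj f"
  proof (rule injI)
    fix z w assume eq: "f z = f w"
    obtain x b where z: "z = (x, b)" by fastforce
    obtain y c where w: "w = (y, c)" by fastforce
    consider "b" | "c" | "\<not> b" "\<not> c" by blast
    then show "z = w"
    proof cases
      case 1
      then have "dt.together {Inr (x, 0)} (std_ray (x, True)) (std_ray w)"
        using together[OF eq, of "{Inr (x, 0)}"] z by simp
      from separate_new_ray[OF this] show ?thesis
        using 1 z by simp
    next
      case 2
      then have "dt.together {Inr (y, 0)} (std_ray (y, True)) (std_ray z)"
        using together[OF eq[symmetric], of "{Inr (y, 0)}"] w by simp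
      from separate_new_ray[OF this] show ?thesis
        using 2 w by simp
    next
      case 3
      then have "seg y n = seg x n" for n
        using separate_branch[of x n x w] together[OF eq finite_initial_cut[of x n]] z w by simp
      then show ?thesis
        using 3 z w seg_eq_all by blast
    qed
  qed
  have "continuous_map (alexandroff_duplicate cantor_set) dt.space f"
    unfolding dt.space_def
  proof (rule continuous_on_generated_topo)
    fix U assume "U \<in> {dt.nbhd S r | S r. S \<in> Collect finite \<and> r \<in> rays dominated_tree}"
    then obtain S r where U: "U = dt.nbhd S r" and S: "finite S" and r: "r \<in> rays dominated_tree"
      by blast
    show "openin (alexandroff_duplicate cantor_set)
        (f -` U \<inter> topspace (alexandroff_duplicate cantor_set))"
      unfolding openin_alexandroff_duplicate_cantor_iff
    proof (intro allI impI)
      fix x assume "(x, False) \<in> f -` U \<inter> topspace (alexandroff_duplicate cantor_set)"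
      then have rx: "dt.together S r (std_ray (x, False))"
        using in_nbhd[OF S r] U by simp
      obtain n where n: "\<And>y b. seg y n = seg x n \<Longrightarrow> (b \<Longrightarrow> \<forall>k. Inr (y, k) \<notin> S) \<Longrightarrow>
          dt.together S (std_ray (x, False)) (std_ray (y, b))"
        using branch_nbhd[OF S] by metis
      \<comment> \<open>Finitely many new rays meet \<open>S\<close>. A long cylinder avoids them
        all except possibly the one at \<open>x\<close>, which accounts for the puncture at
        \<open>(x, True)\<close>. On tree vertices \<open>projr\<close> is unspecified, which merely
        adds values to a finite set.\<close>
      have "finite ((fst \<circ> projr) ` S)"
        using S by simp
      then obtain m where "\<forall>y\<in>(fst \<circ> projr) ` S. seg y m = seg x m \<longrightarrow> y = x"
        using finite_separated_from by blast
      then have m: "\<forall>k. Inr (y, k) \<notin> S" if "seg y m = seg x m" "y \<noteq> x" for y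
        using that by force
      show "\<exists>n. \<forall>y. seg y n = seg x n \<longrightarrow>
          (y, False) \<in> f -` U \<inter> topspace (alexandroff_duplicate cantor_set) \<and>
          (y \<noteq> x \<longrightarrow> (y, True) \<in> f -` U \<inter> topspace (alexandroff_duplicate cantor_set))"
      proof (intro exI[of _ "max n m"] allI impI)
        fix y assume "seg y (max n m) = seg x (max n m)"
        then have y: "seg y n = seg x n" "seg y m = seg x m"
          by (simp_all add: seg_eq_iff)
        have "(y, b) \<in> f -` U" if "b \<Longrightarrow> y \<noteq> x" for b
        proof -
          have "dt.together S (std_ray (x, False)) (std_ray (y, b))"
            using n[OF y(1)] m[OF y(2)] that by blast
          then have "dt.together S r (std_ray (y, b))"
            using dt.together_trans[OF _ r std_ray_in_rays std_ray_in_rays rx] S by simp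
          then show ?thesis
            using in_nbhd[OF S r] U by simp
        qed
        then show "(y, False) \<in> f -` U \<inter> topspace (alexandroff_duplicate cantor_set) \<and>
            (y \<noteq> x \<longrightarrow> (y, True) \<in> f -` U \<inter> topspace (alexandroff_duplicate cantor_set))"
          by simp
      qed
    qed
  next
    show "f ` topspace (alexandroff_duplicate cantor_set)
        \<subseteq> \<Union> {dt.nbhd S r | S r. S \<in> Collect finite \<and> r \<in> rays dominated_tree}"
      using topspace by (simp add: dt.space_def)
  qed
  moreover have "open_map (alexandroff_duplicate cantor_set) dt.space f"
    unfolding open_map_def
  proof (intro allI impI)
    fix W assume W: "openin (alexandroff_duplicate cantor_set) W"
    show "openin dt.space (f ` W)"
    proof (subst openin_subopen, intro ballI)
      fix u assume "u \<in> f ` W"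
      then obtain z where z: "z \<in> W" "u = f z" by blast
      obtain x b where xb: "z = (x, b)" by fastforce
      have "\<exists>S. finite S \<and> (\<forall>w. dt.together S (std_ray z) (std_ray w) \<longrightarrow> w \<in> W)"
      proof (cases b)
        case True
        then show ?thesis
          using separate_new_ray z xb by (intro exI[of _ "{Inr (x, 0)}"]) auto
      next
        case False
        then have "(x, False) \<in> W"
          using z xb by simp
        with W obtain n where
          n: "\<And>y. seg y n = seg x n \<Longrightarrow> (y, False) \<in> W \<and> (y \<noteq> x \<longrightarrow> (y, True) \<in> W)"
          unfolding openin_alexandroff_duplicate_cantor_iff by metis
        have "w \<in> W" if "dt.together (initial_cut x n) (std_ray z) (std_ray w)" for w
        proof -
          have w: "seg (fst w) n = seg x n" "w \<noteq> (x, True)"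
            using separate_branch[of x n x w] that xb False by auto
          obtain y c where y: "w = (y, c)" by fastforce
          with w n[of y] show ?thesis by (cases c) auto
        qed
        then show ?thesis
          using finite_initial_cut by blast
      qed
      then obtain S where S: "finite S" "\<And>w. dt.together S (std_ray z) (std_ray w) \<Longrightarrow> w \<in> W"
        by blast
      have "dt.nbhd S (std_ray z) \<subseteq> f ` W"
      proof
        fix v assume v: "v \<in> dt.nbhd S (std_ray z)"
        then obtain w where w: "v = f w"
          using nbhd_sub[OF S(1) std_ray_in_rays] by blast
        with v have "w \<in> W"
          using S(2) in_nbhd[OF S(1) std_ray_in_rays] by simp
        with w show "v \<in> f ` W" by blast
      qed
      moreover have "u \<in> dt.nbhd S (std_ray z)"
        using in_nbhd[OF S(1) std_ray_in_rays] together[OF refl S(1)] z by simp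
      moreover have "openin dt.space (dt.nbhd S (std_ray z))"
        using dt.openin_nbhd S(1) std_ray_in_rays by simp
      ultimately show "\<exists>T. openin dt.space T \<and> u \<in> T \<and> T \<subseteq> f ` W" by blast
    qed
  qed
  ultimately have "homeomorphic_map (alexandroff_duplicate cantor_set) dt.space f"
    by (rule bijective_open_imp_homeomorphic_map) (use inj topspace in simp_all)
  then have "alexandroff_duplicate cantor_set homeomorphic_space dt.space"
    by (rule homeomorphic_map_imp_homeomorphic_space)
  then show ?thesis
    by (simp add: end_space_eq[OF simple_dominated_tree])
qed


section \<open>Uncountable families\<close>

lemma uncountable_pigeonhole:
  assumes "uncountable A" "countable B" "\<And>x. x \<in> A \<Longrightarrow> f x \<in> B"
  obtains b where "b \<in> B" "uncountable {x \<in> A. f x = b}"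
proof -
  have "A = (\<Union>b\<in>B. {x \<in> A. f x = b})"
    using assms(3) by blast
  then have "\<not> (\<forall>b\<in>B. countable {x \<in> A. f x = b})"
    using assms(1,2) by (metis (no_types, lifting) countable_UN)
  with that show thesis by blast
qed

lemma countable_at_most_one:
  assumes "\<And>x y. x \<in> S \<Longrightarrow> y \<in> S \<Longrightarrow> x = y"
  shows "countable S"
proof (cases "S = {}")
  case False
  then obtain x where "x \<in> S" by blast
  then have "S \<subseteq> {x}" using assms by blast
  then show ?thesis using countable_subset by blast
qed simp

text \<open>If some \<open>e\<close> lies in uncountably many \<open>D x\<close>, remove it and use
  induction. Otherwise countably many of these finite sets meet only countably many others, so a
  maximal disjoint subfamily is uncountable. The family is indexed: sets may repeat, and
  distinctness refers to indices.\<close>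

lemma delta_system_card:
  assumes "uncountable A" "\<And>x. x \<in> A \<Longrightarrow> finite (D x) \<and> card (D x) = n"
  shows "\<exists>A' R. A' \<subseteq> A \<and> uncountable A' \<and> pairwise (\<lambda>x y. D x \<inter> D y = R) A'"
  using assms
proof (induction n arbitrary: A D)
  case 0
  then have "D x = {}" if "x \<in> A" for x
    using that by (metis card_0_eq)
  then have "pairwise (\<lambda>x y. D x \<inter> D y = {}) A"
    by (simp add: pairwise_def)
  with 0 show ?case
    by (intro exI[of _ A] exI[of _ "{}"]) simp
next
  case (Suc n)
  show ?case
  proof (cases "\<exists>e. uncountable {x \<in> A. e \<in> D x}")
    case True
    then obtain e where e: "uncountable {x \<in> A. e \<in> D x}" by blast
    have "finite (D x - {e}) \<and> card (D x - {e}) = n" if "x \<in> {x \<in> A. e \<in> D x}" for x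
      using Suc.prems(2)[of x] that by simp
    then have "\<exists>A' R. A' \<subseteq> {x \<in> A. e \<in> D x} \<and> uncountable A' \<and>
        pairwise (\<lambda>x y. (D x - {e}) \<inter> (D y - {e}) = R) A'"
      by (rule Suc.IH[OF e])
    then obtain A' R where A': "A' \<subseteq> {x \<in> A. e \<in> D x}" "uncountable A'"
      and R: "pairwise (\<lambda>x y. (D x - {e}) \<inter> (D y - {e}) = R) A'"
      by (elim exE conjE)
    have "D x \<inter> D y = insert e R" if "x \<in> A'" "y \<in> A'" "x \<noteq> y" for x y
    proof -
      have "(D x - {e}) \<inter> (D y - {e}) = R" "e \<in> D x" "e \<in> D y"
        using pairwiseD[OF R that] A'(1) that by auto
      then show ?thesis by blast
    qed
    then have "pairwise (\<lambda>x y. D x \<inter> D y = insert e R) A'"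
      by (simp add: pairwise_def)
    with A' show ?thesis
      by (intro exI[of _ A'] exI[of _ "insert e R"]) auto
  next
    case False
    define \<A> where "\<A> = {B. B \<subseteq> A \<and> pairwise (\<lambda>x y. D x \<inter> D y = {}) B}"
    have "\<exists>M\<in>\<A>. \<forall>X\<in>\<A>. M \<subseteq> X \<longrightarrow> X = M"
    proof (rule subset_Zorn_nonempty)
      show "\<A> \<noteq> {}"
        unfolding \<A>_def by (metis (mono_tags, lifting) empty_iff empty_subsetI mem_Collect_eq pairwise_empty)
      fix \<C> assume "subset.chain \<A> \<C>"
      then have C: "\<C> \<subseteq> \<A>" "\<And>B B'. B \<in> \<C> \<Longrightarrow> B' \<in> \<C> \<Longrightarrow> B \<subseteq> B' \<or> B' \<subseteq> B"
        by (auto simp: subset.chain_def subset_chain_def)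
      have "D x \<inter> D y = {}" if xy: "x \<in> \<Union>\<C>" "y \<in> \<Union>\<C>" "x \<noteq> y" for x y
      proof -
        obtain B where "B \<in> \<C>" "x \<in> B" "y \<in> B"
          using xy C(2) by (meson UnionE subsetD)
        then have "pairwise (\<lambda>x y. D x \<inter> D y = {}) B"
          using C(1) by (auto simp: \<A>_def)
        then show ?thesis
          using \<open>x \<in> B\<close> \<open>y \<in> B\<close> xy(3) by (rule pairwiseD)
      qed
      moreover have "\<Union>\<C> \<subseteq> A"
        using C(1) by (auto simp: \<A>_def)
      ultimately show "\<Union>\<C> \<in> \<A>"
        by (simp add: \<A>_def pairwise_def)
    qed
    then obtain M where M: "M \<in> \<A>" "\<And>X. X \<in> \<A> \<Longrightarrow> M \<subseteq> X \<Longrightarrow> X = M"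
      by blast
    have "uncountable M"
    proof
      assume cM: "countable M"
      have MA: "M \<subseteq> A" using M(1) by (simp add: \<A>_def)
      have "A \<subseteq> M \<union> (\<Union>e\<in>(\<Union>x\<in>M. D x). {x \<in> A. e \<in> D x})"
      proof
        fix x assume x: "x \<in> A"
        show "x \<in> M \<union> (\<Union>e\<in>(\<Union>x\<in>M. D x). {x \<in> A. e \<in> D x})"
        proof (rule ccontr)
          assume n: "x \<notin> M \<union> (\<Union>e\<in>(\<Union>x\<in>M. D x). {x \<in> A. e \<in> D x})"
          then have "D x \<inter> D y = {}" if "y \<in> M" for y
            using that x by blast
          then have "insert x M \<in> \<A>"
            using M(1) x by (auto simp: \<A>_def pairwise_insert Int_commute)
          then show False
            using M(2) n by blast
        qed
      qed
      moreover have "countable (\<Union>x\<in>M. D x)"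
        using cM MA Suc.prems(2) by (intro countable_UN) (auto intro: countable_finite)
      then have "countable (\<Union>e\<in>(\<Union>x\<in>M. D x). {x \<in> A. e \<in> D x})"
        by (rule countable_UN) (use False in blast)
      with cM have "countable (M \<union> (\<Union>e\<in>(\<Union>x\<in>M. D x). {x \<in> A. e \<in> D x}))"
        by (rule countable_Un)
      ultimately show False
        using Suc.prems(1) countable_subset by metis
    qed
    with M(1) show ?thesis
      by (intro exI[of _ M] exI[of _ "{}"]) (simp add: \<A>_def)
  qed
qed

lemma delta_system:
  assumes "uncountable A" "\<And>x. x \<in> A \<Longrightarrow> finite (D x)"
  obtains A' R where "A' \<subseteq> A" "uncountable A'" "finite R"
    "\<And>x y. x \<in> A' \<Longrightarrow> y \<in> A' \<Longrightarrow> x \<noteq> y \<Longrightarrow> D x \<inter> D y = R"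
proof -
  obtain n where n: "uncountable {x \<in> A. card (D x) = n}"
    using uncountable_pigeonhole[of A "UNIV :: nat set" "\<lambda>x. card (D x)"] assms(1) by auto
  obtain A' R where A': "A' \<subseteq> A" "uncountable A'" and R: "pairwise (\<lambda>x y. D x \<inter> D y = R) A'"
    using delta_system_card[OF n, of D n] assms(2) by blast
  have "infinite A'"
    using A'(2) countable_finite by blast
  then obtain x y where "x \<in> A'" "y \<in> A'" "x \<noteq> y"
    by (metis finite.emptyI finite.insertI finite_subset insertI1 subsetI)
  moreover from this have "R \<subseteq> D x"
    using R by (auto simp: pairwise_def)
  ultimately have "finite R"
    using assms(2) A'(1) finite_subset by blast
  with that A' R show thesis
    by (simp add: pairwise_def)
qed

text \<open>There are only countably many words. If every point had a cylinder with countable trace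
  on \<open>A\<close>, these traces would cover \<open>A\<close>. The point found need not lie in
  \<open>A\<close>.\<close>

lemma condensation_point:
  fixes A :: "(nat \<Rightarrow> bool) set"
  assumes "uncountable A"
  obtains a where "\<And>n. uncountable {y \<in> A. seg y n = seg a n}"
proof (rule ccontr)
  assume "\<not> thesis"
  with that have n: "\<exists>n. countable {y \<in> A. seg y n = seg a n}" for a
    by metis
  let ?S = "{s. countable {y \<in> A. seg y (length s) = s}}"
  have "countable (\<Union>s\<in>?S. {y \<in> A. seg y (length s) = s})"
    by (intro countable_UN) auto
  moreover have "A \<subseteq> (\<Union>s\<in>?S. {y \<in> A. seg y (length s) = s})"
  proof
    fix a assume "a \<in> A"
    obtain m where "countable {y \<in> A. seg y m = seg a m}" using n by blast
    with \<open>a \<in> A\<close> show "a \<in> (\<Union>s\<in>?S. {y \<in> A. seg y (length s) = s})"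
      by (intro UN_I[of "seg a m"]) auto
  qed
  ultimately show False
    using assms countable_subset by blast
qed

lemma uncountable_Cantor: "uncountable (UNIV :: (nat \<Rightarrow> bool) set)"
proof
  assume "countable (UNIV :: (nat \<Rightarrow> bool) set)"
  then obtain f :: "nat \<Rightarrow> nat \<Rightarrow> bool" where "surj f"
    by (metis UNIV_not_empty range_from_nat_into)
  then obtain k where "f k = (\<lambda>n. \<not> f n n)"
    by (metis surjD)
  then show False by metis
qed

section \<open>Isolated edge-ends accumulate at a vertex\<close>

text \<open>Let \<open>F x\<close> cut off the component \<open>X x\<close> with the end of \<open>\<pi> x\<close>, and let \<open>P x\<close> be a path from
  \<open>v\<^sub>0\<close> to \<open>X x\<close>. If the sets \<open>F x \<union> P x\<close> form a \<open>\<Delta>\<close>-system, then the paths become disjoint outside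
  of its root, and no vertex lies in uncountably many \<open>X x\<close>: a ray in \<open>X x\<close> from such a
  vertex to the end of \<open>\<pi> x\<close> avoids the root of the sets \<open>F y\<close>, so it avoids some \<open>F y\<close> and ends
  up in \<open>X y\<close> as well. Hence a finite cut affects only countably many of the paths and the \<open>X x\<close>.\<close>

lemma isolated_edge_ends_accumulate:
  fixes G :: "'a ugraph" and \<pi> :: "'b \<Rightarrow> nat \<Rightarrow> 'a"
  assumes G: "simple_graph G" and A: "uncountable A"
    and ray: "\<And>x. x \<in> A \<Longrightarrow> ray_seq G (\<pi> x)"
    and con: "\<And>x. x \<in> A \<Longrightarrow> (v\<^sub>0, \<pi> x 0) \<in> econn (edges G)"
    and F: "\<And>x. x \<in> A \<Longrightarrow> finite (F x) \<and> F x \<subseteq> edges G"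
    and sep: "\<And>x y. x \<in> A \<Longrightarrow> y \<in> A \<Longrightarrow> x \<noteq> y \<Longrightarrow>
        edge_separates G (F x) (ray_of (\<pi> x)) (ray_of (\<pi> y))"
  obtains v A' where "A' \<subseteq> A" "uncountable A'"
    "\<And>C. finite C \<Longrightarrow> C \<subseteq> edges G \<Longrightarrow>
      countable {x \<in> A'. \<not> (\<exists>N. \<forall>i\<ge>N. (v, \<pi> x i) \<in> econn (edges G - C))}"
proof -
  let ?E = "edges G"
  interpret ee: end_system G "{F. finite F \<and> F \<subseteq> edges G}" "delete_edges G"
    by (rule edge_end_system[OF G])
  have "\<forall>x\<in>A. \<exists>N. \<forall>n\<ge>N. {\<pi> x n, \<pi> x (Suc n)} \<in> ?E - F x"
    using ee.eventually_in F ray by (simp add: edges_delete_edges)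
  \<comment> \<open>The set \<open>X x\<close> described above is the component of
    \<open>\<pi> x (N x)\<close> in \<open>edges G - F x\<close>.\<close>
  then obtain N where N: "\<And>x n. x \<in> A \<Longrightarrow> N x \<le> n \<Longrightarrow> {\<pi> x n, \<pi> x (Suc n)} \<in> ?E - F x"
    by metis
  have "\<exists>P. finite P \<and> P \<subseteq> ?E \<and> (v\<^sub>0, \<pi> x (N x)) \<in> econn P" if "x \<in> A" for x
  proof -
    have "(\<pi> x 0, \<pi> x (N x)) \<in> econn ?E"
      using ray[OF that] by (intro econn_seq) (auto simp: ray_seq_def)
    then have "(v\<^sub>0, \<pi> x (N x)) \<in> econn ?E"
      using con[OF that] econn_trans by metis
    then show ?thesis by (metis econn_finite_edges)
  qed
  then obtain P where P: "\<And>x. x \<in> A \<Longrightarrow> finite (P x)" "\<And>x. x \<in> A \<Longrightarrow> P x \<subseteq> ?E"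
    "\<And>x. x \<in> A \<Longrightarrow> (v\<^sub>0, \<pi> x (N x)) \<in> econn (P x)"
    by metis
  \<comment> \<open>One root controls the overlaps among the cuts, needed for \<open>few\<close>,
    and among the paths, needed for \<open>rest\<close>.\<close>
  obtain A1 R where A1: "A1 \<subseteq> A" "uncountable A1" and finR: "finite R"
    and R: "\<And>x y. x \<in> A1 \<Longrightarrow> y \<in> A1 \<Longrightarrow> x \<noteq> y \<Longrightarrow> (F x \<union> P x) \<inter> (F y \<union> P y) = R"
    by (rule delta_system[OF A, of "\<lambda>x. F x \<union> P x"]) (use F P(1) in auto)
  have fin_Union: "finite (\<Union>C)" if "finite C" "C \<subseteq> ?E" for C
    using that G unfolding simple_graph_def
    by (metis card.infinite finite_Union subsetD zero_neq_numeral)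
  have RE: "R \<subseteq> ?E"
  proof -
    have "infinite A1"
      using A1(2) countable_finite by blast
    then obtain x y where "x \<in> A1" "y \<in> A1" "x \<noteq> y"
      by (metis finite.emptyI finite.insertI finite_subset insertI1 subsetI)
    then show ?thesis
      using R[of x y] F P(2) A1(1) by blast
  qed
  \<comment> \<open>Discard each path up to its last edge in \<open>R\<close>. The remaining parts
    are pairwise disjoint, so a finite cut hits only finitely many of them, even if it contains all
    of \<open>R\<close>.\<close>
  have "\<forall>x\<in>A. \<exists>v. v \<in> insert v\<^sub>0 (\<Union>R) \<and> (v, \<pi> x (N x)) \<in> econn (P x - R)"
    using econn_avoiding P(3) by metis
  then obtain start where start: "\<And>x. x \<in> A \<Longrightarrow> start x \<in> insert v\<^sub>0 (\<Union>R)"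
    "\<And>x. x \<in> A \<Longrightarrow> (start x, \<pi> x (N x)) \<in> econn (P x - R)"
    by metis
  \<comment> \<open>The trace of \<open>F x\<close> on the root and the starting vertex range over
    finite sets, so both can be made constant on an uncountable subfamily.\<close>
  have "countable (Pow R \<times> insert v\<^sub>0 (\<Union>R))"
    using finR fin_Union[OF finR RE] by (intro countable_finite) simp
  moreover have "(F x \<inter> R, start x) \<in> Pow R \<times> insert v\<^sub>0 (\<Union>R)" if "x \<in> A1" for x
    using start(1) A1(1) that by blast
  ultimately obtain Rv where Rv: "uncountable {x \<in> A1. (F x \<inter> R, start x) = Rv}"
    using uncountable_pigeonhole[OF A1(2), of _ "\<lambda>x. (F x \<inter> R, start x)"] by metis
  obtain R1 v where "Rv = (R1, v)" by fastforce
  define A2 where "A2 = {x \<in> A1. F x \<inter> R = R1 \<and> start x = v}"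
  have A2: "A2 \<subseteq> A1" "A2 \<subseteq> A" "uncountable A2"
    using Rv A1(1) \<open>Rv = (R1, v)\<close> by (auto simp: A2_def)
  have few: "countable {x \<in> A2. (\<pi> x (N x), w) \<in> econn (?E - F x)}" for w
  proof (rule ccontr)
    define B where "B = {x \<in> A2. (\<pi> x (N x), w) \<in> econn (?E - F x)}"
    assume "uncountable {x \<in> A2. (\<pi> x (N x), w) \<in> econn (?E - F x)}"
    then have B: "uncountable B" by (simp add: B_def)
    then obtain x where x: "x \<in> B" by fastforce
    then have xA: "x \<in> A" "x \<in> A1" "F x \<inter> R = R1"
      using A2 by (auto simp: B_def A2_def)
    have "(w, \<pi> x (N x)) \<in> econn (?E - F x)"
      using x by (simp add: B_def econn_sym)
    then obtain Q where Q: "finite Q" "Q \<subseteq> ?E - F x" "(w, \<pi> x (N x)) \<in> econn Q"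
      by (rule econn_finite_edges)
    \<comment> \<open>\<open>W\<close> leads from \<open>w\<close> to the end of
      \<open>\<pi> x\<close> without using \<open>F x\<close>. It is infinite but countable, so
      uncountably many candidates \<open>y\<close> are needed to find one whose cut misses all of
      it.\<close>
    define W where "W = Q \<union> (\<lambda>n. {\<pi> x n, \<pi> x (Suc n)}) ` {N x..}"
    have W: "W \<subseteq> ?E - F x"
      using Q(2) N[OF xA(1)] by (auto simp: W_def)
    \<comment> \<open>Here the common trace matters: an edge of two cuts \<open>F y\<close> and
      \<open>F z\<close> lies in \<open>R\<close>, hence in \<open>R1\<close> and in
      \<open>F x\<close>, which \<open>W\<close> avoids.\<close>
    have "countable {y \<in> A2 - {x}. e \<in> F y}" if "e \<in> W" for e
    proof (rule countable_at_most_one, rule ccontr)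
      fix y z assume yz: "y \<in> {y \<in> A2 - {x}. e \<in> F y}" "z \<in> {y \<in> A2 - {x}. e \<in> F y}" "y \<noteq> z"
      then have "e \<in> R"
        using R[of y z] A2(1) by blast
      then have "e \<in> F x"
        using yz(1) xA(3) by (auto simp: A2_def)
      then show False
        using W that by blast
    qed
    moreover have "countable W"
      using Q(1) by (simp add: W_def countable_finite)
    ultimately have "countable (\<Union>e\<in>W. {y \<in> A2 - {x}. e \<in> F y})"
      by (intro countable_UN) auto
    then have "\<not> B \<subseteq> insert x (\<Union>e\<in>W. {y \<in> A2 - {x}. e \<in> F y})"
      using B countable_subset countable_insert by metis
    then obtain y where y: "y \<in> B" "y \<noteq> x" "F y \<inter> W = {}"
      by (auto simp: B_def)
    then have yA: "y \<in> A" "(\<pi> y (N y), w) \<in> econn (?E - F y)"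
      using A2 by (auto simp: B_def)
    have Wy: "W \<subseteq> ?E - F y"
      using W y(3) by blast
    have "(w, \<pi> x (N x)) \<in> econn (?E - F y)"
      by (rule econn_mono[OF Q(3)]) (use Wy in \<open>simp add: W_def\<close>)
    then have "(\<pi> y (N y), \<pi> x (N x)) \<in> econn (?E - F y)"
      using yA(2) econn_trans by metis
    moreover have "{\<pi> x n, \<pi> x (Suc n)} \<in> ?E - F y" if "N x \<le> n" for n
      using Wy that by (auto simp: W_def)
    ultimately have "ee.together (F y) (ray_of (\<pi> y)) (ray_of (\<pi> x))"
      using ee.together_iff[of "F y" "\<pi> y" "\<pi> x" "N y" "N x"] F[OF yA(1)] ray yA(1) xA(1) N
      by (simp add: edges_delete_edges)
    then show False
      using sep[OF yA(1) xA(1) y(2)] by (simp add: ee.together_def edge_separates_def)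
  qed
  have rest: "countable {x \<in> A2. \<not> (\<exists>N. \<forall>i\<ge>N. (v, \<pi> x i) \<in> econn (?E - C))}"
    if C: "finite C" "C \<subseteq> ?E" for C
  proof -
    \<comment> \<open>\<open>?X\<close> collects the \<open>x\<close> for which an endpoint of an
      edge of \<open>C\<close> lies on the side of \<open>\<pi> x\<close>, \<open>?Y\<close> those
      whose shortened path uses an edge of \<open>C\<close>. For all other \<open>x\<close> the path
      and the ray from \<open>N x\<close> on survive the cut.\<close>
    let ?X = "\<Union>w\<in>\<Union>C. {x \<in> A2. (\<pi> x (N x), w) \<in> econn (?E - F x)}"
    let ?Y = "\<Union>e\<in>C. {x \<in> A2. e \<in> P x - R}"
    have "countable ?X"
      using countable_finite[OF fin_Union[OF C]] few by (rule countable_UN)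
    moreover have "countable {x \<in> A2. e \<in> P x - R}" for e
      by (rule countable_at_most_one) (use R A2(1) in blast)
    then have "countable ?Y"
      by (rule countable_UN[OF countable_finite[OF C(1)]])
    moreover have "{x \<in> A2. \<not> (\<exists>N. \<forall>i\<ge>N. (v, \<pi> x i) \<in> econn (?E - C))} \<subseteq> ?X \<union> ?Y"
    proof (rule subsetI, rule ccontr)
      fix x assume xn: "x \<in> {x \<in> A2. \<not> (\<exists>N. \<forall>i\<ge>N. (v, \<pi> x i) \<in> econn (?E - C))}"
        and xXY: "x \<notin> ?X \<union> ?Y"
      have x: "x \<notin> ?X" "x \<notin> ?Y"
        by (rule contrapos_nn[OF xXY], erule UnI1, rule contrapos_nn[OF xXY], erule UnI2)
      from xn have xA2: "x \<in> A2" and n: "\<not> (\<exists>N. \<forall>i\<ge>N. (v, \<pi> x i) \<in> econn (?E - C))"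
        by simp_all
      have xA: "x \<in> A" "start x = v"
        using xA2 A2(2) by (auto simp: A2_def)
      have "(v, \<pi> x (N x)) \<in> econn (P x - R)"
        using start(2)[OF xA(1)] xA(2) by simp
      moreover have "P x - R \<subseteq> ?E - C"
        using P(2)[OF xA(1)] xA2 x(2) by blast
      ultimately have "(v, \<pi> x (N x)) \<in> econn (?E - C)"
        by (rule econn_mono)
      moreover have "(\<pi> x (N x), \<pi> x i) \<in> econn (?E - C)" if "N x \<le> i" for i
      proof (rule econn_seq[OF _ that])
        fix j assume j: "N x \<le> j"
        have "(\<pi> x (N x), \<pi> x j) \<in> econn (?E - F x)"
          using N[OF xA(1)] by (intro econn_seq j) auto
        then have "\<pi> x j \<notin> \<Union>C"
          using xA2 x(1) by blast
        then show "{\<pi> x j, \<pi> x (Suc j)} \<in> ?E - C"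
          using N[OF xA(1) j] by blast
      qed
      ultimately show False
        using n econn_trans by metis
    qed
    ultimately show ?thesis
      by (meson countable_Un countable_subset)
  qed
  show thesis
    by (rule that[OF A2(2,3) rest])
qed

section \<open>The duplicate is not an edge-end space\<close>

lemma not_homeomorphic_edge_end_space:
  assumes G: "simple_graph G"
  shows "\<not> alexandroff_duplicate cantor_set homeomorphic_space edge_end_space G"
proof
  interpret ee: end_system G "{F. finite F \<and> F \<subseteq> edges G}" "delete_edges G"
    by (rule edge_end_system[OF G])
  let ?I = "{F. finite F \<and> F \<subseteq> edges G}"
  assume "alexandroff_duplicate cantor_set homeomorphic_space edge_end_space G"
  then obtain f where f: "homeomorphic_map (alexandroff_duplicate cantor_set) ee.space f"
    unfolding edge_end_space_eq[OF G] homeomorphic_space by blast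
  have inj: "inj f" and im: "range f = ee.cls ` rays G"
    using f by (simp_all add: homeomorphic_eq_everything_map ee.topspace_space)
  have op: "openin ee.space (f ` W)" if "openin (alexandroff_duplicate cantor_set) W" for W
    using f that by (simp add: homeomorphic_eq_everything_map open_map_def)
  have cont: "openin (alexandroff_duplicate cantor_set) (f -` U)" if "openin ee.space U" for U
    using f that openin_continuous_map_preimage[of "alexandroff_duplicate cantor_set" ee.space f U]
    by (simp add: homeomorphic_eq_everything_map vimage_def)
  have "\<exists>p. ray_seq G p \<and> f z = ee.cls (ray_of p)" for z
  proof -
    obtain r where "r \<in> rays G" "f z = ee.cls r" using im by blast
    then show ?thesis
      using rays_iff[OF G] by metis
  qed
  then obtain \<pi> where \<pi>: "\<And>z. ray_seq G (\<pi> z)" "\<And>z. f z = ee.cls (ray_of (\<pi> z))"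
    by metis
  define \<rho> where "\<rho> z = ray_of (\<pi> z)" for z
  have ray: "\<rho> z \<in> rays G" for z
    unfolding \<rho>_def rays_iff[OF G] using \<pi>(1) by blast
  have in_nbhd: "f w \<in> ee.nbhd F (\<rho> z) \<longleftrightarrow> ee.together F (\<rho> z) (\<rho> w)" if "F \<in> ?I" for F z w
    using ee.cls_in_nbhd_iff[OF that ray ray] \<pi>(2) by (simp add: \<rho>_def)
  \<comment> \<open>\<open>inside\<close> expresses that \<open>f\<close> is open,
    \<open>near\<close> that it is continuous, both in terms of cuts.\<close>
  have inside: "\<exists>F\<in>?I. \<forall>w. ee.together F (\<rho> z) (\<rho> w) \<longrightarrow> w \<in> W"
    if W: "openin (alexandroff_duplicate cantor_set) W" "z \<in> W" for W z
  proof -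
    have "ee.cls (\<rho> z) \<in> f ` W"
      using W(2) \<pi>(2) by (auto simp: \<rho>_def)
    then obtain F where F: "F \<in> ?I" "ee.nbhd F (\<rho> z) \<subseteq> f ` W"
      by (rule ee.space_base[OF op[OF W(1)] ray])
    have "w \<in> W" if "ee.together F (\<rho> z) (\<rho> w)" for w
    proof -
      have "f w \<in> f ` W"
        using in_nbhd[OF F(1)] that F(2) by blast
      then show ?thesis
        by (simp add: inj_image_mem_iff[OF inj])
    qed
    with F(1) show ?thesis by blast
  qed
  have near: "\<exists>n. \<forall>y. seg y n = seg a n \<longrightarrow> y \<noteq> a \<longrightarrow> ee.together F (\<rho> (a, False)) (\<rho> (y, True))"
    if F: "F \<in> ?I" for F a
  proof -
    have "openin (alexandroff_duplicate cantor_set) (f -` ee.nbhd F (\<rho> (a, False)))"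
      using cont ee.openin_nbhd[OF F ray] by blast
    moreover have "(a, False) \<in> f -` ee.nbhd F (\<rho> (a, False))"
      using in_nbhd[OF F] ee.together_refl[OF F ray] by simp
    ultimately show ?thesis
      unfolding openin_alexandroff_duplicate_cantor_iff vimage_eq in_nbhd[OF F] by metis
  qed

  have "\<exists>F\<in>?I. \<forall>w. ee.together F (\<rho> (y, True)) (\<rho> w) \<longrightarrow> w = (y, True)" for y
    using inside[of "{(y, True)}" "(y, True)"]
    by (simp add: openin_alexandroff_duplicate_cantor_iff)
  then obtain F where F: "\<And>y. F y \<in> ?I"
    "\<And>y w. ee.together (F y) (\<rho> (y, True)) (\<rho> w) \<Longrightarrow> w = (y, True)"
    by metis

  \<comment> \<open>Being together under the empty cut means lying in the same component of
    \<open>G\<close>. A cylinder around \<open>a\<^sub>0\<close> therefore supplies uncountably many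
    isolated edge-ends whose rays are reachable from one vertex.\<close>
  obtain a\<^sub>0 :: "nat \<Rightarrow> bool" where a\<^sub>0: "\<And>n. uncountable {y. seg y n = seg a\<^sub>0 n}"
    using condensation_point[OF uncountable_Cantor] by auto
  obtain k where k: "\<And>y. seg y k = seg a\<^sub>0 k \<Longrightarrow> y \<noteq> a\<^sub>0 \<Longrightarrow>
      ee.together {} (\<rho> (a\<^sub>0, False)) (\<rho> (y, True))"
    using near[of "{}" a\<^sub>0] by auto
  define A where "A = {y. seg y k = seg a\<^sub>0 k} - {a\<^sub>0}"
  have uA: "uncountable A"
    unfolding A_def using a\<^sub>0 by (simp add: uncountable_minus_countable)
  have con: "(\<pi> (a\<^sub>0, False) 0, \<pi> (y, True) 0) \<in> econn (edges G)" if "y \<in> A" for y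
    using k[of y] that ee.together_iff[OF _ \<pi>(1) \<pi>(1), of "{}" 0 "(a\<^sub>0, False)" 0 "(y, True)"] \<pi>(1)
    by (simp add: A_def \<rho>_def edges_delete_edges ray_seq_def)
  have sep: "edge_separates G (F x) (ray_of (\<pi> (x, True))) (ray_of (\<pi> (y, True)))"
    if "x \<noteq> y" for x y
    using F(2)[of x "(y, True)"] that by (auto simp: ee.together_def edge_separates_def \<rho>_def)
  obtain v A' where A': "uncountable A'"
    and v: "\<And>C. finite C \<Longrightarrow> C \<subseteq> edges G \<Longrightarrow>
      countable {x \<in> A'. \<not> (\<exists>N. \<forall>i\<ge>N. (v, \<pi> (x, True) i) \<in> econn (edges G - C))}"
    by (rule isolated_edge_ends_accumulate[OF G uA, of "\<lambda>y. \<pi> (y, True)" "\<pi> (a\<^sub>0, False) 0" F])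
      (use \<pi>(1) con F(1) sep in auto)

  \<comment> \<open>The subset \<open>A'\<close> need not accumulate at \<open>a\<^sub>0\<close>, so
    a condensation point is chosen anew.\<close>
  obtain a where a: "\<And>n. uncountable {y \<in> A'. seg y n = seg a n}"
    using condensation_point[OF A'] by blast
  have "countable {y \<in> A'. seg y n \<noteq> seg a n}" for n
  proof -
    have "openin (alexandroff_duplicate cantor_set) {w. seg (fst w) n = seg a n}"
      unfolding openin_alexandroff_duplicate_cantor_iff by (auto intro: exI[of _ n])
    then obtain C where C: "C \<in> ?I"
      and far: "\<And>y. ee.together C (\<rho> (a, False)) (\<rho> (y, True)) \<Longrightarrow> seg y n = seg a n"
      using inside[of "{w. seg (fst w) n = seg a n}" "(a, False)"] by auto
    define bad where "bad = {x \<in> A'. \<not> (\<exists>N. \<forall>i\<ge>N. (v, \<pi> (x, True) i) \<in> econn (edges G - C))}"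
    have bad: "countable bad"
      using v C by (simp add: bad_def)
    have good: "ee.together C (\<rho> (y, True)) (\<rho> (z, True))"
      if yz: "y \<in> A' - bad" "z \<in> A' - bad" for y z
    proof -
      obtain N M where N: "\<And>i. N \<le> i \<Longrightarrow> (v, \<pi> (y, True) i) \<in> econn (edges G - C)"
        and M: "\<And>i. M \<le> i \<Longrightarrow> (v, \<pi> (z, True) i) \<in> econn (edges G - C)"
        using yz by (auto simp: bad_def)
      obtain N' M' where
        N': "\<And>i. N' \<le> i \<Longrightarrow> {\<pi> (y, True) i, \<pi> (y, True) (Suc i)} \<in> edges (delete_edges G C)" and
        M': "\<And>i. M' \<le> i \<Longrightarrow> {\<pi> (z, True) i, \<pi> (z, True) (Suc i)} \<in> edges (delete_edges G C)"
        using ee.eventually_in[OF C \<pi>(1)] by metis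
      have "(\<pi> (y, True) (max N N'), \<pi> (z, True) (max M M')) \<in> econn (edges (delete_edges G C))"
        using econn_trans[OF econn_sym[OF N[of "max N N'"]] M[of "max M M'"]]
        by (simp add: edges_delete_edges)
      then show ?thesis
        using ee.together_iff[OF C \<pi>(1) \<pi>(1), of "max N N'" "(y, True)" "max M M'" "(z, True)"] N' M'
        by (simp add: \<rho>_def)
    qed
    obtain m where m: "\<And>y. seg y m = seg a m \<Longrightarrow> y \<noteq> a \<Longrightarrow>
        ee.together C (\<rho> (a, False)) (\<rho> (y, True))"
      using near[OF C] by blast
    \<comment> \<open>A single good \<open>y\<close> near \<open>a\<close> puts
      \<open>(a, False)\<close> on the side of \<open>v\<close>, and with it all other good points.
      It must differ from \<open>a\<close>, because \<open>near\<close> says nothing about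
      \<open>(a, True)\<close>.\<close>
    have "\<not> {y \<in> A'. seg y m = seg a m} \<subseteq> insert a bad"
      using a[of m] bad countable_subset countable_insert by metis
    then obtain y where y: "y \<in> A' - bad" "seg y m = seg a m" "y \<noteq> a"
      by blast
    have "seg z n = seg a n" if "z \<in> A' - bad" for z
      using far ee.together_trans[OF C ray ray ray m[OF y(2,3)] good[OF y(1) that]] by blast
    then have "{y \<in> A'. seg y n \<noteq> seg a n} \<subseteq> bad"
      by blast
    with bad show ?thesis
      using countable_subset by blast
  qed
  then have "countable (insert a (\<Union>n. {y \<in> A'. seg y n \<noteq> seg a n}))"
    by auto
  moreover have "A' \<subseteq> insert a (\<Union>n. {y \<in> A'. seg y n \<noteq> seg a n})"
    using seg_eq_all by blast
  ultimately show False
    using A' countable_subset by blast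
qed

theorem corollary4p6:
  shows "(\<forall>G :: 'a ugraph. simple_graph G \<longrightarrow>
            \<not> alexandroff_duplicate cantor_set homeomorphic_space edge_end_space G) \<and>
         (\<exists>H :: continuum_vertex ugraph. simple_graph H \<and>
            alexandroff_duplicate cantor_set homeomorphic_space end_space H)"
  using not_homeomorphic_edge_end_space simple_dominated_tree homeomorphic_dominated_tree by blast

end
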